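(* There exist universal constants $c,c'>0$ such that the following holds. Let $n\in\mathbb{N}$, $\sigma^2>0$, $0<\tau_1\le\dots\le\tau_n$, $L,\Delta>0$ and $0<\varepsilon\le c'L\Delta$. Let $A=\{A_d\}_{d\in\mathbb{N}}$ be a family of zero-respecting algorithms for the time multiple oracles protocol. Then there exist $d\in\mathbb{N}$, differentiable functions $f_1,\dots,f_n:\mathbb{R}^d\to\mathbb{R}$ with $f=\frac1n\sum_{i=1}^nf_i\in\mathcal{F}_{\Delta,L}$, and an admissible choice of oracles and distributions from $\mathcal{O}^{\sigma^2,\mathrm{heterog}}_{\tau_1,\dots,\tau_n}(f_1,\dots,f_n)$ such that, when $A_d$ is run in the protocol, $$\mathbb{E}\Big[\inf_{k\in S_t}\|\nabla f(x^k)\|^2\Big]>\varepsilon\quad\text{for}\quad t=c\left(\tau_n\frac{L\Delta}{\varepsilon}+\Big(\frac1n\sum_{i=1}^n\tau_i\Big)\frac{\sigma^2L\Delta}{n\varepsilon^2}\right).$$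
   Context: Notation: $[n]=\{1,\dots,n\}$, $\mathbb{N}_0=\{0,1,2,\dots\}$; for $x\in\mathbb{R}^d$, $\mathrm{supp}(x)=\{i\in[d]: x_i\neq0\}$. Time multiple oracles protocol. There are $n$ oracles $O_1,\dots,O_n$ with distributions $\mathcal{D}_1,\dots,\mathcal{D}_n$ on a sample space $\mathbb{S}_\xi$. An algorithm is a sequence $A=\{A^k\}_{k\ge0}$ with $A^0\in\mathbb{R}_{\ge0}\times[n]\times\mathbb{R}^d$ and $A^k:(\mathbb{R}^d)^k\to\mathbb{R}_{\ge0}\times[n]\times\mathbb{R}^d$ for $k\ge1$, such that for all $k\ge1$ and all $g^1,\dots,g^k$ the first (time) component of $A^k(g^1,\dots,g^k)$ is at least the first component of $A^{k-1}(g^1,\dots,g^{k-1})$. Each oracle $i$ has a state in $\mathbb{R}_{\ge0}\times\mathbb{R}^d\times\{0,1\}$, initially $s_i^0=(0,0,0)$. Set $t^0=0$. For $k=0,1,2,\dots$: $(t^{k+1},i^{k+1},x^k)=A^k(g^1,\dots,g^k)$ ($=A^0$ for $k=0$); draw $\xi^{k+1}\sim\mathcal{D}_{i^{k+1}}$ independently of everything before; $(s^{k+1}_{i^{k+1}},g^{k+1})=O_{i^{k+1}}(t^{k+1},x^k,s^k_{i^{k+1}},\xi^{k+1})$, and $s^{k+1}_j=s^k_j$ for $j\ne i^{k+1}$. For $t\ge0$, $S_t=\{k\in\mathbb{N}_0: t^k\le t\}$. Delayed oracle. For $\tau>0$ and a mapping $G:\mathbb{R}^d\times\mathbb{S}_\xi\to\mathbb{R}^d$,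 the oracle $O^G_\tau(t,x,(s_t,s_x,s_q),\xi)$ returns $((t,x,1),0)$ if $s_q=0$; $((s_t,s_x,1),0)$ if $s_q=1$ and $t<s_t+\tau$; $((0,0,0),G(s_x;\xi))$ if $s_q=1$ and $t\ge s_t+\tau$. Zero-respecting: an algorithm is zero-respecting if $\mathrm{supp}(x^k)\subseteq\bigcup_{j=1}^k\mathrm{supp}(g^j)$ for all $k\in\mathbb{N}_0$ and all realizations (so $x^0=0$). Function class $\mathcal{F}_{\Delta,L}$: differentiable $f:\mathbb{R}^d\to\mathbb{R}$ with $\|\nabla f(x)-\nabla f(y)\|\le L\|x-y\|$ for all $x,y$ and $f(0)-\inf_x f(x)\le\Delta$. Oracle class $\mathcal{O}^{\sigma^2,\mathrm{heterog}}_{\tau_1,\dots,\tau_n}(f_1,\dots,f_n)$: an admissible choice consists of a sample space, distributions $\mathcal{D}_1,\dots,\mathcal{D}_n$ and mappings $G_1,\dots,G_n:\mathbb{R}^d\times\mathbb{S}_\xi\to\mathbb{R}^d$ such that for all $x$ and $i$, $\mathbb{E}_{\xi\sim\mathcal{D}_i}[G_i(x;\xi)]=\nabla f_i(x)$ and $\mathbb{E}_{\xi\sim\mathcal{D}_i}\|G_i(x;\xi)-\nabla f_i(x)\|^2\le\sigma^2$; the oracles are $O_i=O^{G_i}_{\tau_i}$. *)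

theory Defs
  imports "HOL-Probability.Probability"
begin

text \<open>Vectors of R^d are represented as functions nat => real vanishing from index d on.\<close>

type_synonym vect = "nat \<Rightarrow> real"

definition vecs :: "nat \<Rightarrow> vect set" where
  "vecs d = {x. \<forall>j\<ge>d. x j = 0}"

definition supp :: "vect \<Rightarrow> nat set" where
  "supp x = {j. x j \<noteq> 0}"

definition vzero :: vect where "vzero = (\<lambda>_. 0)"

definition vdiff :: "vect \<Rightarrow> vect \<Rightarrow> vect" where
  "vdiff x y = (\<lambda>j. x j - y j)"

definition inner_d :: "nat \<Rightarrow> vect \<Rightarrow> vect \<Rightarrow> real" where
  "inner_d d x y = (\<Sum>j<d. x j * y j)"

definition norm_d :: "nat \<Rightarrow> vect \<Rightarrow> real" where
  "norm_d d x = sqrt (inner_d d x x)"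

definition has_grad :: "nat \<Rightarrow> (vect \<Rightarrow> real) \<Rightarrow> vect \<Rightarrow> vect \<Rightarrow> bool" where
  "has_grad d f g x \<longleftrightarrow> g \<in> vecs d \<and>
     (\<forall>e>0. \<exists>\<delta>>0. \<forall>y\<in>vecs d. norm_d d (vdiff y x) < \<delta> \<longrightarrow>
        \<bar>f y - f x - inner_d d g (vdiff y x)\<bar> \<le> e * norm_d d (vdiff y x))"

definition in_F :: "nat \<Rightarrow> real \<Rightarrow> real \<Rightarrow> (vect \<Rightarrow> real) \<Rightarrow> (vect \<Rightarrow> vect) \<Rightarrow> bool" where
  "in_F d \<Delta> L f gf \<longleftrightarrow>
     (\<forall>x\<in>vecs d. has_grad d f (gf x) x) \<and>
     (\<forall>x\<in>vecs d. \<forall>y\<in>vecs d. norm_d d (vdiff (gf x) (gf y)) \<le> L * norm_d d (vdiff x y)) \<and>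
     (\<forall>x\<in>vecs d. f vzero - f x \<le> \<Delta>)"

text \<open>An algorithm: A applied to the list [g^1,...,g^k] is A^k; the result is (time, oracle index, point).\<close>
type_synonym algo = "vect list \<Rightarrow> real \<times> nat \<times> vect"

definition alg_ok :: "nat \<Rightarrow> nat \<Rightarrow> algo \<Rightarrow> bool" where
  "alg_ok n d A \<longleftrightarrow>
     (\<forall>gs. set gs \<subseteq> vecs d \<longrightarrow>
        fst (A gs) \<ge> 0 \<and> fst (snd (A gs)) \<in> {1..n} \<and> snd (snd (A gs)) \<in> vecs d \<and>
        (gs \<noteq> [] \<longrightarrow> fst (A (butlast gs)) \<le> fst (A gs)))"

definition zero_respecting :: "nat \<Rightarrow> algo \<Rightarrow> bool" where
  "zero_respecting d A \<longleftrightarrow>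
     (\<forall>gs. set gs \<subseteq> vecs d \<longrightarrow> supp (snd (snd (A gs))) \<subseteq> (\<Union>g\<in>set gs. supp g))"

type_synonym ostate = "real \<times> vect \<times> bool"

definition delayed_oracle ::
  "real \<Rightarrow> (vect \<Rightarrow> 's \<Rightarrow> vect) \<Rightarrow> real \<Rightarrow> vect \<Rightarrow> ostate \<Rightarrow> 's \<Rightarrow> ostate \<times> vect" where
  "delayed_oracle \<tau> G t x s \<xi> =
     (case s of (st, sx, sq) \<Rightarrow>
        if \<not> sq then ((t, x, True), vzero)
        else if t < st + \<tau> then ((st, sx, True), vzero)
        else ((0, vzero, False), G sx \<xi>))"

text \<open>Run of the protocol. The sample \<xi>^{k+1} drawn at step k from oracle i is
  \<omega> (k, i), where all \<omega> (k, i) are independent with law D i.  After k steps we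
  have the list of returned vectors [g^1..g^k] and the oracle states.\<close>
fun run :: "algo \<Rightarrow> (nat \<Rightarrow> real) \<Rightarrow> (nat \<Rightarrow> vect \<Rightarrow> 's \<Rightarrow> vect) \<Rightarrow> (nat \<times> nat \<Rightarrow> 's)
            \<Rightarrow> nat \<Rightarrow> vect list \<times> (nat \<Rightarrow> ostate)" where
  "run A \<tau> G \<omega> 0 = ([], (\<lambda>_. (0, vzero, False)))"
| "run A \<tau> G \<omega> (Suc k) =
     (let (gs, s) = run A \<tau> G \<omega> k;
          (t', i, x) = A gs;
          (s', g) = delayed_oracle (\<tau> i) (G i) t' x (s i) (\<omega> (k, i))
      in (gs @ [g], s(i := s')))"

definition run_time :: "algo \<Rightarrow> (nat \<Rightarrow> real) \<Rightarrow> (nat \<Rightarrow> vect \<Rightarrow> 's \<Rightarrow> vect) \<Rightarrow> (nat \<times> nat \<Rightarrow> 's)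
            \<Rightarrow> nat \<Rightarrow> real" where
  "run_time A \<tau> G \<omega> k = (case k of 0 \<Rightarrow> 0 | Suc j \<Rightarrow> fst (A (fst (run A \<tau> G \<omega> j))))"

definition run_point :: "algo \<Rightarrow> (nat \<Rightarrow> real) \<Rightarrow> (nat \<Rightarrow> vect \<Rightarrow> 's \<Rightarrow> vect) \<Rightarrow> (nat \<times> nat \<Rightarrow> 's)
            \<Rightarrow> nat \<Rightarrow> vect" where
  "run_point A \<tau> G \<omega> k = snd (snd (A (fst (run A \<tau> G \<omega> k))))"

definition admissible_oracles ::
  "nat \<Rightarrow> nat \<Rightarrow> real \<Rightarrow> (nat \<Rightarrow> vect \<Rightarrow> vect) \<Rightarrow> (nat \<Rightarrow> real measure)
     \<Rightarrow> (nat \<Rightarrow> vect \<Rightarrow> real \<Rightarrow> vect) \<Rightarrow> bool" where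
  "admissible_oracles n d \<sigma>2 gf D G \<longleftrightarrow>
     (\<forall>i. prob_space (D i) \<and> sets (D i) = sets borel) \<and>
     (\<forall>i\<in>{1..n}. \<forall>x\<in>vecs d.
        (\<forall>\<xi>. G i x \<xi> \<in> vecs d) \<and>
        (\<forall>j. integrable (D i) (\<lambda>\<xi>. G i x \<xi> j) \<and> (\<integral>\<xi>. G i x \<xi> j \<partial>D i) = gf i x j) \<and>
        (\<integral>\<^sup>+\<xi>. ennreal ((norm_d d (vdiff (G i x \<xi>) (gf i x)))\<^sup>2) \<partial>D i) \<le> ennreal \<sigma>2)"

end

theory Submission
  imports Defs
begin

text \<open>Split the coordinates into n interleaved blocks, coordinate j belonging to worker
  j mod n + 1, and let f_i / n be a scaled chain function supported on block i. In a chain a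
  coordinate can only become nonzero after its predecessor (n places earlier) did, and as long as
  the last coordinate of block i is 0 the gradient of the average has an entry of square at least
  4 \<epsilon> w_i in that block. Oracle i reveals the next coordinate of its block only with probability p_i,
  so that the noise has variance about n^2 \<epsilon> w_i / p_i. By time t oracle i delivers at most
  t / \<tau>_i answers, hence p_i t / \<tau>_i revealing ones in expectation, and by Markov's inequality
  block i is unfinished with probability 3/4 when this is at most a quarter of the chain length.
  The first term of the bound comes from p = 1 and half of the weight on worker n, the second one
  from w_i proportional to \<tau>_i and p_i about n^2 \<epsilon> w_i / \<sigma>^2.\<close>

section \<open>Scalar building blocks\<close>

text \<open>Finished blocks must not hide an unfinished one. As the blocks are disjoint, squared
  gradient entries add up over blocks, and each unfinished block pays its own share. Linearity of
  expectation then suffices: blocks counted with weight at least 1/2, each unfinished with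
  probability at least 3/4, give 3/4 * 4 * 1/2 = 3/2 times \<open>\<epsilon>\<close>. Neither
  concentration nor independence between workers enters. The weights sum to 1, so the possible
  decrease is spent on chain length alone: it is at most 180 \<open>\<epsilon>\<close> T / L for
  chains of length T, whatever n is. Making \<open>w\<close> and \<open>p\<close> proportional to
  \<open>\<tau>\<close> balances the workers: p i / \<open>\<tau> i\<close> is then constant, so all
  blocks advance at the same expected rate. Two obstacles shape the probabilistic part. The
  algorithm is adaptive, so the number of deliveries is random; but whether a step delivers is
  settled before its bit is drawn, and the number of deliveries by time t is bounded on every path.
  Moreover, arbitrarily many queries may fall before time t, so one count of successes over the
  infinite run has to control every admissible k at once.\<close>

definition clamp01 :: "real \<Rightarrow> real" where
  "clamp01 u = max 0 (min 1 u)"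

text \<open>The cubic smoothstep. Its derivative \<open>dstep\<close> is Lipschitz, which is all the
  regularity that an L-smooth function requires.\<close>

definition step :: "real \<Rightarrow> real" where
  "step u = 3 * (clamp01 u)\<^sup>2 - 2 * (clamp01 u) ^ 3"

definition dstep :: "real \<Rightarrow> real" where
  "dstep u = 6 * clamp01 u * (1 - clamp01 u)"

lemma clamp01_bounds: "0 \<le> clamp01 u" "clamp01 u \<le> 1"
  by (auto simp: clamp01_def)

lemma clamp01_lipschitz: "\<bar>clamp01 u - clamp01 v\<bar> \<le> \<bar>u - v\<bar>"
  by (auto simp: clamp01_def max_def min_def)

lemma step_eq_0: "u \<le> 0 \<Longrightarrow> step u = 0"
  and step_eq_1: "1 \<le> u \<Longrightarrow> step u = 1"
  and dstep_eq_0: "u \<le> 0 \<Longrightarrow> dstep u = 0"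
  by (simp_all add: step_def dstep_def clamp01_def max_def)

lemma step_diff:
  "step u - step v = (clamp01 u - clamp01 v)
     * (3 * (clamp01 u + clamp01 v) - 2 * ((clamp01 u)\<^sup>2 + clamp01 u * clamp01 v + (clamp01 v)\<^sup>2))"
  unfolding step_def by algebra

lemma step_lipschitz: "\<bar>step u - step v\<bar> \<le> 3 / 2 * \<bar>u - v\<bar>"
proof -
  have aux: "\<bar>3 * (p + q) - 2 * (p\<^sup>2 + p * q + q\<^sup>2)\<bar> \<le> 3 / 2"
    if "0 \<le> p" "p \<le> 1" "0 \<le> q" "q \<le> 1" for p q :: real
  proof -
    have "3 / 2 - (3 * (p + q) - 2 * (p\<^sup>2 + p * q + q\<^sup>2)) = 3 / 2 * (p + q - 1)\<^sup>2 + (p - q)\<^sup>2 / 2"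
      by (simp add: power2_eq_square field_simps)
    then have "0 \<le> 3 / 2 - (3 * (p + q) - 2 * (p\<^sup>2 + p * q + q\<^sup>2))" by simp
    then have up: "3 * (p + q) - 2 * (p\<^sup>2 + p * q + q\<^sup>2) \<le> 3 / 2" by linarith
    have "p\<^sup>2 \<le> p" "q\<^sup>2 \<le> q" "p * q \<le> p" "p * q \<le> q"
      using that by (simp_all add: power2_eq_square mult_left_le mult_left_le_one_le)
    then have "0 \<le> 3 * (p + q) - 2 * (p\<^sup>2 + p * q + q\<^sup>2)" using that by argo
    then show ?thesis using up by linarith
  qed
  have "\<bar>step u - step v\<bar> \<le> \<bar>clamp01 u - clamp01 v\<bar> * (3 / 2)"
    unfolding step_diff abs_mult
    by (intro mult_left_mono aux clamp01_bounds) simp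
  then show ?thesis using clamp01_lipschitz[of u v] by argo
qed

lemma step_bounds: "0 \<le> step u" "step u \<le> 1"
proof -
  have "0 \<le> p\<^sup>2 * (3 - 2 * p) \<and> (1 - p)\<^sup>2 * (1 + 2 * p) \<ge> 0" if "0 \<le> p" "p \<le> 1" for p :: real
    using that by simp
  moreover have "step u = (clamp01 u)\<^sup>2 * (3 - 2 * clamp01 u)"
    "1 - step u = (1 - clamp01 u)\<^sup>2 * (1 + 2 * clamp01 u)"
    by (simp_all add: step_def power2_eq_square power3_eq_cube algebra_simps)
  ultimately show "0 \<le> step u" "step u \<le> 1"
    using clamp01_bounds[of u] by (metis, smt (verit))
qed

lemma dstep_bounds: "0 \<le> dstep u" "dstep u \<le> 3 / 2"
proof -
  show "0 \<le> dstep u" using clamp01_bounds[of u] by (simp add: dstep_def)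
  have "3 / 2 - dstep u = 6 * (clamp01 u - 1 / 2)\<^sup>2"
    by (simp add: dstep_def power2_eq_square field_simps)
  then show "dstep u \<le> 3 / 2"
    using zero_le_power2[of "clamp01 u - 1 / 2"] by linarith
qed

lemma dstep_lipschitz: "\<bar>dstep u - dstep v\<bar> \<le> 6 * \<bar>u - v\<bar>"
proof -
  have "dstep u - dstep v = 6 * ((clamp01 u - clamp01 v) * (1 - clamp01 u - clamp01 v))"
    by (simp add: dstep_def algebra_simps)
  moreover have "\<bar>(clamp01 u - clamp01 v) * (1 - clamp01 u - clamp01 v)\<bar> \<le> \<bar>clamp01 u - clamp01 v\<bar> * 1"
    unfolding abs_mult using clamp01_bounds[of u] clamp01_bounds[of v]
    by (intro mult_left_mono) linarith+
  ultimately show ?thesis using clamp01_lipschitz[of u v] by (simp add: abs_mult)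
qed

text \<open>On clamped arguments the exact remainder of the cubic has a factor of absolute value at
  most 3; replacing the clamped increment by the true one costs another 6.\<close>

lemma step_taylor: "\<bar>step v - step u - dstep u * (v - u)\<bar> \<le> 9 * (v - u)\<^sup>2"
proof -
  define p q where "p = clamp01 u" and "q = clamp01 v"
  have pq: "0 \<le> p" "p \<le> 1" "0 \<le> q" "q \<le> 1" "\<bar>q - p\<bar> \<le> \<bar>v - u\<bar>"
    unfolding p_def q_def using clamp01_bounds clamp01_lipschitz by auto
  have a: "step v - step u - dstep u * (q - p) = (q - p)\<^sup>2 * (3 - 2 * q - 4 * p)"
    unfolding step_def dstep_def p_def[symmetric] q_def[symmetric] by algebra
  have "\<bar>(q - p)\<^sup>2 * (3 - 2 * q - 4 * p)\<bar> \<le> (q - p)\<^sup>2 * 3"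
    unfolding abs_mult using pq by (intro mult_mono) auto
  also have "\<dots> \<le> 3 * (v - u)\<^sup>2"
    using pq by (simp add: abs_le_square_iff)
  finally have b: "\<bar>step v - step u - dstep u * (q - p)\<bar> \<le> 3 * (v - u)\<^sup>2" using a by simp
  \<comment> \<open>Clamping changes the increment only if u is inside (0,1) and v outside [0,1].
    Then both the overshoot of v and the factor of \<open>dstep u\<close> that vanishes at the
    crossed endpoint are at most the distance from u to v.\<close>
  have c: "\<bar>dstep u * ((v - q) - (u - p))\<bar> \<le> 6 * (v - u)\<^sup>2"
  proof (cases "0 < u \<and> u < 1")
    case False
    then have "dstep u = 0" by (auto simp: dstep_def clamp01_def)
    then show ?thesis by simp
  next
    case True
    then have pu: "p = u" by (auto simp: p_def clamp01_def)
    have e: "dstep u = 6 * (u * (1 - u))" using pu by (simp add: dstep_def p_def)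
    consider "v \<in> {0..1}" | "v < 0" | "v > 1" by force
    then show ?thesis
    proof cases
      case 1
      then have "q = v" by (simp add: q_def clamp01_def)
      then show ?thesis using pu by simp
    next
      case 2
      then have q: "q = 0" by (simp add: q_def clamp01_def)
      have "u * (1 - u) * (- v) \<le> (u - v) * 1 * (u - v)"
        using True 2 by (intro mult_mono) (auto intro: mult_nonneg_nonneg)
      moreover have "0 \<le> u * (1 - u) * (- v)" using True 2 by (intro mult_nonneg_nonneg) auto
      ultimately show ?thesis using 2 True
        by (simp add: e q pu abs_mult power2_eq_square algebra_simps)
    next
      case 3
      then have q: "q = 1" by (simp add: q_def clamp01_def)
      have "(u * (1 - u)) * (v - 1) \<le> (1 * (v - u)) * (v - u)"
        using True 3 by (intro mult_mono) (auto intro: mult_nonneg_nonneg)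
      moreover have "0 \<le> u * (1 - u) * (v - 1)" using True 3 by (intro mult_nonneg_nonneg) auto
      ultimately show ?thesis using 3 True
        by (simp add: e q pu abs_mult power2_eq_square algebra_simps)
    qed
  qed
  have "step v - step u - dstep u * (v - u)
      = (step v - step u - dstep u * (q - p)) - dstep u * ((v - q) - (u - p))"
    by (simp add: algebra_simps)
  then show ?thesis using b c by linarith
qed

text \<open>Smoothstep stretched to rise over [-1,2] and scaled so that its slope
  \<open>dbump\<close> is 1 at 0 and at 1, hence at least 1 in between.\<close>

definition bump :: "real \<Rightarrow> real" where
  "bump u = 9 / 4 * step ((u + 1) / 3)"

definition dbump :: "real \<Rightarrow> real" where
  "dbump u = 3 / 4 * dstep ((u + 1) / 3)"

lemma bump_bounds: "0 \<le> bump u" "bump u \<le> 9 / 4"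
  using step_bounds[of "(u + 1) / 3"] by (auto simp: bump_def)

lemma dbump_bounds: "0 \<le> dbump u" "dbump u \<le> 9 / 8"
  using dstep_bounds[of "(u + 1) / 3"] by (auto simp: dbump_def)

lemma dbump_0: "dbump 0 = 1"
  by (simp add: dbump_def dstep_def clamp01_def)

lemma bump_lipschitz: "\<bar>bump u - bump v\<bar> \<le> 9 / 8 * \<bar>u - v\<bar>"
  using step_lipschitz[of "(u + 1) / 3" "(v + 1) / 3"]
  by (simp add: bump_def abs_if field_simps split: if_splits)

lemma dbump_lipschitz: "\<bar>dbump u - dbump v\<bar> \<le> 3 / 2 * \<bar>u - v\<bar>"
  using dstep_lipschitz[of "(u + 1) / 3" "(v + 1) / 3"]
  by (simp add: dbump_def abs_if field_simps split: if_splits)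

lemma bump_taylor: "\<bar>bump v - bump u - dbump u * (v - u)\<bar> \<le> 9 / 4 * (v - u)\<^sup>2"
proof -
  have e: "(v + 1) / 3 - (u + 1) / 3 = (v - u) / 3" by (simp add: field_simps)
  have "bump v - bump u - dbump u * (v - u)
    = 9 / 4 * (step ((v + 1) / 3) - step ((u + 1) / 3) - dstep ((u + 1) / 3) * ((v - u) / 3))"
    by (simp add: bump_def dbump_def algebra_simps diff_divide_distrib)
  moreover have "\<bar>\<dots>\<bar> \<le> 9 / 4 * (9 * ((v - u) / 3)\<^sup>2)"
    using step_taylor[of "(v + 1) / 3" "(u + 1) / 3"] unfolding e abs_mult
    by (intro mult_mono) auto
  ultimately have "\<bar>bump v - bump u - dbump u * (v - u)\<bar> \<le> 9 / 4 * (9 * ((v - u) / 3)\<^sup>2)" by argo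
  then show ?thesis by (simp add: power_divide)
qed

text \<open>Below -1 the bump is flat, and the slope \<open>min u 0\<close> of the quadratic penalty
  takes over. The penalty is in the chain function for this reason: moving to negative values cannot
  shrink the gradient.\<close>

lemma dbump_minus_penalty:
  assumes "u \<le> 1"
  shows "1 \<le> dbump u - min u 0"
proof -
  consider "u \<le> -1" | "-1 < u" "u < 0" | "0 \<le> u" by linarith
  then show ?thesis
  proof cases
    case 1
    then show ?thesis using dbump_bounds[of u] by auto
  next
    case 2
    then have c: "clamp01 ((u + 1) / 3) = (u + 1) / 3" by (simp add: clamp01_def max_def min_def)
    have "dbump u - min u 0 - 1 = - (u * (u + 1)) / 2"
      using 2 unfolding dbump_def dstep_def c by (simp add: field_simps)
    moreover have "u * (u + 1) \<le> 0" using 2 by (simp add: mult_nonpos_nonneg)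
    ultimately show ?thesis by linarith
  next
    case 3
    then have c: "clamp01 ((u + 1) / 3) = (u + 1) / 3" using assms by (simp add: clamp01_def max_def min_def)
    have "dbump u - min u 0 - 1 = u * (1 - u) / 2"
      using 3 unfolding dbump_def dstep_def c by (simp add: field_simps)
    moreover have "0 \<le> u * (1 - u)" using 3 assms by simp
    ultimately show ?thesis by linarith
  qed
qed

lemma penalty_taylor:
  fixes u v :: real
  shows "\<bar>(min v 0)\<^sup>2 / 2 - (min u 0)\<^sup>2 / 2 - min u 0 * (v - u)\<bar> \<le> (v - u)\<^sup>2 / 2"
proof -
  consider "u \<le> 0" "v \<le> 0" | "u > 0" "v > 0" | "u \<le> 0" "v > 0" | "u > 0" "v \<le> 0" by linarith
  then show ?thesis
  proof cases
    case 1
    have "(min v 0)\<^sup>2 / 2 - (min u 0)\<^sup>2 / 2 - min u 0 * (v - u) = (v - u)\<^sup>2 / 2"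
      using 1 by (simp add: power2_eq_square field_simps)
    then show ?thesis by (simp only: abs_of_nonneg zero_le_power2 zero_le_divide_iff) simp
  next
    case 2
    then show ?thesis by simp
  next
    case 3
    have "u * v \<le> 0" using 3 by (simp add: mult_nonpos_nonneg)
    then have "0 \<le> u * u - 2 * (u * v)" using zero_le_square[of u] by linarith
    moreover have "(min v 0)\<^sup>2 / 2 - (min u 0)\<^sup>2 / 2 - min u 0 * (v - u) = (u * u - 2 * (u * v)) / 2"
      using 3 by (simp add: power2_eq_square field_simps)
    moreover have "(v - u)\<^sup>2 / 2 = (u * u - 2 * (u * v)) / 2 + v * v / 2"
      by (simp add: power2_eq_square field_simps)
    ultimately show ?thesis using zero_le_square[of v] by argo
  next
    case 4
    have "u * v \<le> 0" using 4 by (simp add: mult_nonneg_nonpos)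
    then have "0 \<le> u * u - 2 * (u * v)" using zero_le_square[of u] by linarith
    moreover have "(min v 0)\<^sup>2 / 2 - (min u 0)\<^sup>2 / 2 - min u 0 * (v - u) = v * v / 2"
      using 4 by (simp add: power2_eq_square field_simps)
    moreover have "(v - u)\<^sup>2 / 2 = (u * u - 2 * (u * v)) / 2 + v * v / 2"
      by (simp add: power2_eq_square field_simps)
    ultimately show ?thesis using zero_le_square[of v] by argo
  qed
qed

section \<open>The chain function\<close>

lemma norm_d_eq_L2_set: "norm_d d x = L2_set x {..<d}"
  by (simp add: norm_d_def inner_d_def L2_set_def power2_eq_square)

lemma norm_d_power2: "(norm_d d x)\<^sup>2 = (\<Sum>j<d. (x j)\<^sup>2)"
  by (simp add: norm_d_eq_L2_set L2_set_def sum_nonneg)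

text \<open>All pieces of the chain function have Lipschitz derivatives, so a quadratic remainder is
  available and replaces a calculus of derivatives for \<open>has_grad\<close>.\<close>

lemma has_grad_if_quadratic:
  assumes g: "g \<in> vecs d"
    and q: "\<And>y. y \<in> vecs d \<Longrightarrow>
      \<bar>f y - f x - inner_d d g (vdiff y x)\<bar> \<le> C * (norm_d d (vdiff y x))\<^sup>2"
  shows "has_grad d f g x"
  unfolding has_grad_def
proof (intro conjI g allI impI)
  fix e :: real assume e: "e > 0"
  show "\<exists>\<delta>>0. \<forall>y\<in>vecs d. norm_d d (vdiff y x) < \<delta> \<longrightarrow>
        \<bar>f y - f x - inner_d d g (vdiff y x)\<bar> \<le> e * norm_d d (vdiff y x)"
  proof (intro exI[of _ "e / (\<bar>C\<bar> + 1)"] conjI ballI impI)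
    show "0 < e / (\<bar>C\<bar> + 1)" using e by (simp add: add_nonneg_pos)
    fix y assume y: "y \<in> vecs d" and less: "norm_d d (vdiff y x) < e / (\<bar>C\<bar> + 1)"
    let ?r = "norm_d d (vdiff y x)"
    have r: "0 \<le> ?r" by (simp add: norm_d_eq_L2_set L2_set_nonneg)
    have "C * ?r \<le> (\<bar>C\<bar> + 1) * ?r" using r by (intro mult_right_mono) auto
    also have "\<dots> \<le> e" using less by (simp add: field_simps)
    finally have "C * ?r * ?r \<le> e * ?r" using r by (rule mult_right_mono)
    then show "\<bar>f y - f x - inner_d d g (vdiff y x)\<bar> \<le> e * ?r"
      using q[OF y] by (simp add: power2_eq_square mult.assoc)
  qed
qed

text \<open>The predecessor of a coordinate of the first chain layer counts as already reached, hence
  the value 1. Scale s and weights a are indexed by coordinates and have period n.\<close>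

definition chain_pre :: "nat \<Rightarrow> vect \<Rightarrow> vect \<Rightarrow> nat \<Rightarrow> real" where
  "chain_pre n s x j = (if j < n then 1 else x (j - n) / s j)"

definition chain_fun :: "nat \<Rightarrow> nat \<Rightarrow> vect \<Rightarrow> vect \<Rightarrow> vect \<Rightarrow> real" where
  "chain_fun n d s a x =
     (\<Sum>j<d. a j * ((min (x j / s j) 0)\<^sup>2 / 2 - step (chain_pre n s x j) * bump (x j / s j)))"

definition chain_grad :: "nat \<Rightarrow> nat \<Rightarrow> vect \<Rightarrow> vect \<Rightarrow> vect \<Rightarrow> vect" where
  "chain_grad n d s a x j = (if j < d then a j / s j *
     (min (x j / s j) 0 - step (chain_pre n s x j) * dbump (x j / s j)
      - (if j + n < d then dstep (x j / s j) * bump (x (j + n) / s j) else 0)) else 0)"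

lemma chain_grad_in_vecs: "chain_grad n d s a x \<in> vecs d"
  by (simp add: chain_grad_def vecs_def)

text \<open>Product rule with remainder: the Taylor errors of the factors and of the penalty, plus
  the product of the two increments. The constants are rough, since they only serve
  differentiability.\<close>

lemma chain_term_taylor:
  "\<bar>((min u' 0)\<^sup>2 / 2 - step p' * bump u') - ((min u 0)\<^sup>2 / 2 - step p * bump u)
     - (min u 0 - step p * dbump u) * (u' - u) + dstep p * bump u * (p' - p)\<bar>
   \<le> 4 * (u' - u)\<^sup>2 + 22 * (p' - p)\<^sup>2"
proof -
  define R1 R2 R3 where "R1 = step p' - step p - dstep p * (p' - p)"
    and "R2 = bump u' - bump u - dbump u * (u' - u)"
    and "R3 = (min u' 0)\<^sup>2 / 2 - (min u 0)\<^sup>2 / 2 - min u 0 * (u' - u)"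
  have "\<bar>bump u * R1\<bar> \<le> 9 / 4 * (9 * (p' - p)\<^sup>2)"
    unfolding abs_mult R1_def using bump_bounds[of u] by (intro mult_mono step_taylor) auto
  moreover have "\<bar>step p * R2\<bar> \<le> 1 * (9 / 4 * (u' - u)\<^sup>2)"
    unfolding abs_mult R2_def using step_bounds[of p] by (intro mult_mono bump_taylor) auto
  moreover have "\<bar>R3\<bar> \<le> (u' - u)\<^sup>2 / 2"
    unfolding R3_def by (rule penalty_taylor)
  moreover have "\<bar>(step p' - step p) * (bump u' - bump u)\<bar> \<le> (3 / 2 * \<bar>p' - p\<bar>) * (9 / 8 * \<bar>u' - u\<bar>)"
    unfolding abs_mult by (intro mult_mono step_lipschitz bump_lipschitz) auto
  moreover have "2 * (\<bar>p' - p\<bar> * \<bar>u' - u\<bar>) \<le> (p' - p)\<^sup>2 + (u' - u)\<^sup>2"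
    using zero_le_power2[of "\<bar>p' - p\<bar> - \<bar>u' - u\<bar>"] unfolding power2_diff power2_abs by linarith
  moreover have "((min u' 0)\<^sup>2 / 2 - step p' * bump u') - ((min u 0)\<^sup>2 / 2 - step p * bump u)
     - (min u 0 - step p * dbump u) * (u' - u) + dstep p * bump u * (p' - p)
     = R3 - bump u * R1 - step p * R2 - (step p' - step p) * (bump u' - bump u)"
    unfolding R1_def R2_def R3_def by algebra
  ultimately show ?thesis
    using zero_le_power2[of "p' - p"] zero_le_power2[of "u' - u"] unfolding abs_le_iff by linarith
qed

text \<open>The derivative of term j in its predecessor belongs to gradient entry j - n; this
  regroups sums over terms into sums over entries.\<close>

lemma sum_shift_less:
  fixes g :: "nat \<Rightarrow> 'a::comm_monoid_add"
  shows "(\<Sum>j<d. if j < n then 0 else g (j - n)) = (\<Sum>j<d. if j + n < d then g j else 0)"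
proof -
  have "(\<Sum>j<d. if j < n then 0 else g (j - n)) = (\<Sum>j\<in>{..<d} - {..<n}. g (j - n))"
    by (intro sum.mono_neutral_cong_right) auto
  also have "\<dots> = (\<Sum>j\<in>{j. j + n < d}. g j)"
    by (rule sum.reindex_bij_witness[of _ "\<lambda>j. j + n" "\<lambda>j. j - n"]) auto
  also have "\<dots> = (\<Sum>j<d. if j + n < d then g j else 0)"
    by (intro sum.mono_neutral_cong_left) auto
  finally show ?thesis .
qed

lemma has_grad_chain:
  assumes per: "\<And>j. s (j + n) = s j" "\<And>j. a (j + n) = a j" and s: "\<And>j. s j \<noteq> 0"
  shows "has_grad d (chain_fun n d s a) (chain_grad n d s a x) x"
proof (rule has_grad_if_quadratic[OF chain_grad_in_vecs])
  fix y
  let ?N = "(norm_d d (vdiff y x))\<^sup>2"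
  define u v p q where "u j = x j / s j" and "v j = y j / s j"
    and "p = chain_pre n s x" and "q = chain_pre n s y" for j
  define R where "R j = ((min (v j) 0)\<^sup>2 / 2 - step (q j) * bump (v j))
    - ((min (u j) 0)\<^sup>2 / 2 - step (p j) * bump (u j))
    - (min (u j) 0 - step (p j) * dbump (u j)) * (v j - u j)
    + dstep (p j) * bump (u j) * (q j - p j)" for j
  have N: "(y j - x j)\<^sup>2 \<le> ?N" if "j < d" for j
    unfolding norm_d_power2 vdiff_def
    using that by (intro member_le_sum[where f = "\<lambda>j. (y j - x j)\<^sup>2"]) auto
  define h where "h j = a j / s j * (dstep (u j) * bump (x (j + n) / s j)) * (y j - x j)" for j
  have "a j * (dstep (p j) * bump (u j) * (q j - p j)) = (if j < n then 0 else h (j - n))" for j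
    using per[of "j - n"] by (auto simp: p_def q_def u_def h_def chain_pre_def diff_divide_distrib[symmetric])
  then have shift: "(\<Sum>j<d. a j * (dstep (p j) * bump (u j) * (q j - p j)))
    = (\<Sum>j<d. if j + n < d then h j else 0)"
    by (simp add: sum_shift_less)
  have g: "chain_grad n d s a x j * (y j - x j)
    = a j * ((min (u j) 0 - step (p j) * dbump (u j)) * (v j - u j))
      - (if j + n < d then h j else 0)"
    if "j < d" for j
    using that by (simp add: chain_grad_def u_def v_def p_def h_def algebra_simps diff_divide_distrib)
  have "inner_d d (chain_grad n d s a x) (vdiff y x)
    = (\<Sum>j<d. a j * ((min (u j) 0 - step (p j) * dbump (u j)) * (v j - u j))) -
      (\<Sum>j<d. if j + n < d then h j else 0)"
    unfolding inner_d_def vdiff_def sum_subtractf[symmetric] by (intro sum.cong refl g) auto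
  then have "chain_fun n d s a y - chain_fun n d s a x - inner_d d (chain_grad n d s a x) (vdiff y x)
    = (\<Sum>j<d. a j * R j)"
    unfolding shift[symmetric] chain_fun_def
    by (simp add: R_def u_def v_def p_def q_def sum_subtractf sum.distrib algebra_simps)
  also have "\<bar>\<dots>\<bar> \<le> (\<Sum>j<d. \<bar>a j\<bar> * (26 / (s j)\<^sup>2 * ?N))"
  proof (rule order_trans[OF sum_abs sum_mono])
    fix j assume "j \<in> {..<d}"
    then have j: "j < d" by simp
    have "\<bar>R j\<bar> \<le> 4 * (v j - u j)\<^sup>2 + 22 * (q j - p j)\<^sup>2"
      unfolding R_def by (rule chain_term_taylor)
    moreover have "(v j - u j)\<^sup>2 \<le> ?N / (s j)\<^sup>2"
      using N[OF j] by (simp add: u_def v_def diff_divide_distrib[symmetric] power_divide divide_right_mono)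
    moreover have "(q j - p j)\<^sup>2 \<le> ?N / (s j)\<^sup>2"
      using N[of "j - n"] j
      by (simp add: p_def q_def chain_pre_def diff_divide_distrib[symmetric] power_divide divide_right_mono)
    ultimately have "\<bar>R j\<bar> \<le> 26 / (s j)\<^sup>2 * ?N" by simp
    then show "\<bar>a j * R j\<bar> \<le> \<bar>a j\<bar> * (26 / (s j)\<^sup>2 * ?N)"
      unfolding abs_mult by (rule mult_left_mono) simp
  qed
  also have "\<dots> = (\<Sum>j<d. \<bar>a j\<bar> * (26 / (s j)\<^sup>2)) * ?N"
    by (simp add: sum_distrib_right mult.assoc)
  finally show "\<bar>chain_fun n d s a y - chain_fun n d s a x - inner_d d (chain_grad n d s a x) (vdiff y x)\<bar>
    \<le> (\<Sum>j<d. \<bar>a j\<bar> * (26 / (s j)\<^sup>2)) * ?N" .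
qed

section \<open>Smoothness, value gap and gradient size of the chain function\<close>

lemma abs_mult_diff_le:
  fixes a b c e :: real
  assumes "\<bar>a\<bar> \<le> A" "\<bar>e\<bar> \<le> B" "\<bar>b - e\<bar> \<le> K" "\<bar>a - c\<bar> \<le> M"
  shows "\<bar>a * b - c * e\<bar> \<le> A * K + B * M"
proof -
  have "\<bar>a * (b - e)\<bar> \<le> A * K" unfolding abs_mult using assms by (intro mult_mono) auto
  moreover have "\<bar>e * (a - c)\<bar> \<le> B * M" unfolding abs_mult using assms by (intro mult_mono) auto
  moreover have "a * b - c * e = a * (b - e) + e * (a - c)" by algebra
  ultimately show ?thesis by linarith
qed

text \<open>An entry depends on its own coordinate with constant 1 + 3/2 + 9/4 * 6 = 16 and on each
  chain neighbour with 9/8 * 3/2 = 27/16. Shifting along the chain does not increase the norm, so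
  the total stays below 20, the divisor in \<open>a\<close>.\<close>

lemma chain_grad_lipschitz:
  assumes s: "\<And>j. s j > 0" and a: "\<And>j. a j = L * (s j)\<^sup>2 / 20" and L: "L > 0"
  shows "norm_d d (vdiff (chain_grad n d s a x) (chain_grad n d s a y)) \<le> L * norm_d d (vdiff x y)"
proof -
  define e where "e j = \<bar>x j - y j\<bar>" for j
  define lo hi where "lo j = (if j < n then 0 else e (j - n))"
    and "hi j = (if j + n < d then e (j + n) else 0)" for j
  have e0: "0 \<le> e j" for j by (simp add: e_def)
  have pointwise: "\<bar>chain_grad n d s a x j - chain_grad n d s a y j\<bar>
      \<le> L / 20 * (16 * e j + 27 / 16 * lo j + 27 / 16 * hi j)" if j: "j < d" for j
  proof -
    let ?u = "x j / s j" and ?v = "y j / s j" and ?p = "chain_pre n s x j" and ?q = "chain_pre n s y j"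
    have uv: "\<bar>?u - ?v\<bar> = e j / s j" and up: "\<bar>x (j + n) / s j - y (j + n) / s j\<bar> = e (j + n) / s j"
      using s[of j] by (simp_all add: e_def diff_divide_distrib[symmetric] less_imp_le)
    have pq: "\<bar>?p - ?q\<bar> = lo j / s j"
      using s[of j] by (simp add: chain_pre_def lo_def e_def diff_divide_distrib[symmetric] less_imp_le)
    have "\<bar>min ?u 0 - min ?v 0\<bar> \<le> e j / s j" using uv by (auto simp: min_def)
    moreover have "\<bar>step ?p * dbump ?u - step ?q * dbump ?v\<bar> \<le> 1 * (3 / 2 * (e j / s j)) + 9 / 8 * (3 / 2 * (lo j / s j))"
      using step_bounds[of ?p] dbump_bounds[of ?v] dbump_lipschitz[of ?u ?v] step_lipschitz[of ?p ?q]
      unfolding uv pq by (intro abs_mult_diff_le) auto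
    moreover have "\<bar>(if j + n < d then dstep ?u * bump (x (j + n) / s j) else 0)
        - (if j + n < d then dstep ?v * bump (y (j + n) / s j) else 0)\<bar>
      \<le> 3 / 2 * (9 / 8 * (hi j / s j)) + 9 / 4 * (6 * (e j / s j))"
    proof (cases "j + n < d")
      case True
      then show ?thesis
        using dstep_bounds[of ?u] bump_bounds[of "y (j + n) / s j"] dstep_lipschitz[of ?u ?v]
          bump_lipschitz[of "x (j + n) / s j" "y (j + n) / s j"]
        unfolding uv up hi_def if_P[OF True] by (intro abs_mult_diff_le) auto
    qed (use e0[of j] s[of j] in \<open>simp add: hi_def\<close>)
    ultimately have "\<bar>(min ?u 0 - step ?p * dbump ?u - (if j + n < d then dstep ?u * bump (x (j + n) / s j) else 0))
      - (min ?v 0 - step ?q * dbump ?v - (if j + n < d then dstep ?v * bump (y (j + n) / s j) else 0))\<bar>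
      \<le> (16 * e j + 27 / 16 * lo j + 27 / 16 * hi j) / s j" (is "\<bar>?X - ?Y\<bar> \<le> _")
      unfolding add_divide_distrib by simp
    then have "L * s j / 20 * \<bar>?X - ?Y\<bar> \<le> L * s j / 20 * ((16 * e j + 27 / 16 * lo j + 27 / 16 * hi j) / s j)"
      using L s[of j] by (intro mult_left_mono) auto
    also have "\<dots> = L / 20 * (16 * e j + 27 / 16 * lo j + 27 / 16 * hi j)"
      using s[of j] by simp
    also have "L * s j / 20 * \<bar>?X - ?Y\<bar> = \<bar>L * s j / 20 * ?X - L * s j / 20 * ?Y\<bar>"
      using L s[of j] unfolding right_diff_distrib[symmetric] abs_mult by simp
    also have "L * s j / 20 * ?X = chain_grad n d s a x j"
      using s[of j] j by (simp add: chain_grad_def a power2_eq_square)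
    also have "L * s j / 20 * ?Y = chain_grad n d s a y j"
      using s[of j] j by (simp add: chain_grad_def a power2_eq_square)
    finally show ?thesis .
  qed
  let ?N = "L2_set e {..<d}"
  have lo: "L2_set lo {..<d} \<le> ?N"
  proof -
    have "(\<Sum>j<d. (lo j)\<^sup>2) = (\<Sum>j<d. if j < n then 0 else (\<lambda>j. (e j)\<^sup>2) (j - n))"
      by (intro sum.cong) (auto simp: lo_def)
    also have "\<dots> = (\<Sum>j<d. if j + n < d then (e j)\<^sup>2 else 0)" by (rule sum_shift_less)
    also have "\<dots> \<le> (\<Sum>j<d. (e j)\<^sup>2)" by (intro sum_mono) auto
    finally show ?thesis by (simp add: L2_set_def)
  qed
  have hi: "L2_set hi {..<d} \<le> ?N"
  proof -
    have "(\<Sum>j<d. (hi j)\<^sup>2) = (\<Sum>j<d. if j + n < d then (\<lambda>j. (e (j + n))\<^sup>2) j else 0)"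
      by (intro sum.cong) (auto simp: hi_def)
    also have "\<dots> = (\<Sum>j<d. if j < n then 0 else (e (j - n + n))\<^sup>2)" by (rule sum_shift_less[symmetric])
    also have "\<dots> \<le> (\<Sum>j<d. (e j)\<^sup>2)" by (intro sum_mono) auto
    finally show ?thesis by (simp add: L2_set_def)
  qed
  have "norm_d d (vdiff (chain_grad n d s a x) (chain_grad n d s a y))
    = L2_set (\<lambda>j. \<bar>chain_grad n d s a x j - chain_grad n d s a y j\<bar>) {..<d}"
    by (simp add: norm_d_eq_L2_set vdiff_def L2_set_def)
  also have "\<dots> \<le> L2_set (\<lambda>j. L / 20 * (16 * e j + 27 / 16 * lo j + 27 / 16 * hi j)) {..<d}"
    by (intro L2_set_mono pointwise) auto
  also have "\<dots> = L / 20 * L2_set (\<lambda>j. 16 * e j + 27 / 16 * lo j + 27 / 16 * hi j) {..<d}"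
    using L by (intro L2_set_right_distrib[symmetric]) simp
  also have "\<dots> \<le> L / 20 * (16 * ?N + 27 / 16 * L2_set lo {..<d} + 27 / 16 * L2_set hi {..<d})"
    using L L2_set_triangle_ineq[of "\<lambda>j. 16 * e j + 27 / 16 * lo j" "\<lambda>j. 27 / 16 * hi j" "{..<d}"]
      L2_set_triangle_ineq[of "\<lambda>j. 16 * e j" "\<lambda>j. 27 / 16 * lo j" "{..<d}"]
      L2_set_right_distrib[of 16 e "{..<d}"] L2_set_right_distrib[of "27 / 16" lo "{..<d}"]
      L2_set_right_distrib[of "27 / 16" hi "{..<d}"]
    by (intro mult_left_mono) linarith+
  also have "\<dots> \<le> L / 20 * (20 * ?N)"
    using lo hi L L2_set_nonneg[of e "{..<d}"] by (intro mult_left_mono) linarith+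
  finally show ?thesis by (simp add: norm_d_eq_L2_set vdiff_def L2_set_def e_def)
qed

text \<open>At the origin the penalty vanishes and no term is positive; anywhere a term is at least
  -9/4 times its weight.\<close>

lemma chain_fun_gap:
  assumes "\<And>j. a j \<ge> 0"
  shows "chain_fun n d s a vzero - chain_fun n d s a x \<le> 9 / 4 * (\<Sum>j<d. a j)"
proof -
  have "chain_fun n d s a vzero \<le> 0"
    unfolding chain_fun_def
    using step_bounds bump_bounds assms by (intro sum_nonpos mult_nonneg_nonpos) (auto simp: vzero_def)
  moreover have "- (9 / 4 * (\<Sum>j<d. a j)) \<le> chain_fun n d s a x"
    unfolding chain_fun_def sum_distrib_left sum_negf[symmetric]
  proof (rule sum_mono)
    fix j
    have "step (chain_pre n s x j) * bump (x j / s j) \<le> 1 * (9 / 4)"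
      using step_bounds bump_bounds by (intro mult_mono) auto
    then have "- (9 / 4) \<le> (min (x j / s j) 0)\<^sup>2 / 2 - step (chain_pre n s x j) * bump (x j / s j)"
      using zero_le_power2[of "min (x j / s j) 0"] by linarith
    from mult_left_mono[OF this assms[of j]]
    show "- (9 / 4 * a j) \<le> a j * ((min (x j / s j) 0)\<^sup>2 / 2 - step (chain_pre n s x j) * bump (x j / s j))"
      by simp
  qed
  ultimately show ?thesis by linarith
qed

text \<open>At the first position of the block with scaled value below 1 the predecessor is fully
  reached, so its \<open>step\<close> is 1 and \<open>dbump_minus_penalty\<close> applies. The
  coupling to the successor has the same sign, so nothing cancels.\<close>

lemma chain_grad_large:
  assumes s: "\<And>j. s j > 0" "\<And>j. s (j + n) = s j" and a: "\<And>j. a j \<ge> 0" and "b < n" and "m < T"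
    and zero: "x (b + m * n) = 0"
  shows "\<exists>k<T. a (b + k * n) / s (b + k * n) \<le> \<bar>chain_grad n (n * T) s a x (b + k * n)\<bar>"
proof -
  define k where "k = (LEAST k. x (b + k * n) / s (b + k * n) < 1)"
  define j where "j = b + k * n"
  have ex: "x (b + m * n) / s (b + m * n) < 1" using zero by simp
  have k: "x j / s j < 1" unfolding k_def j_def by (rule LeastI[of _ m]) (rule ex)
  have "k \<le> m" unfolding k_def by (rule Least_le) (rule ex)
  then have kT: "k < T" using \<open>m < T\<close> by simp
  have "(k + 1) * n \<le> T * n" using kT by (intro mult_le_mono1) simp
  then have jd: "j < n * T" using \<open>b < n\<close> by (simp add: j_def algebra_simps)
  have "1 \<le> chain_pre n s x j"
  proof (cases k)
    case 0
    then show ?thesis using \<open>b < n\<close> by (simp add: chain_pre_def j_def)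
  next
    case (Suc k')
    have "\<not> x (b + k' * n) / s (b + k' * n) < 1"
      using not_less_Least[of k' "\<lambda>k. x (b + k * n) / s (b + k * n) < 1"] Suc
      unfolding k_def[symmetric] by simp
    then show ?thesis using Suc s(2)[of "b + k' * n"]
      by (simp add: chain_pre_def j_def algebra_simps)
  qed
  then have st: "step (chain_pre n s x j) = 1" by (rule step_eq_1)
  have as: "0 \<le> a j / s j" using a[of j] s(1)[of j] by simp
  have "1 \<le> dbump (x j / s j) - min (x j / s j) 0" using k by (intro dbump_minus_penalty) simp
  moreover have "0 \<le> (if j + n < n * T then dstep (x j / s j) * bump (x (j + n) / s j) else 0)"
    using dstep_bounds bump_bounds by simp
  ultimately have "1 \<le> \<bar>min (x j / s j) 0 - step (chain_pre n s x j) * dbump (x j / s j)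
      - (if j + n < n * T then dstep (x j / s j) * bump (x (j + n) / s j) else 0)\<bar>" (is "_ \<le> \<bar>?X\<bar>")
    unfolding st by linarith
  then have "a j / s j * 1 \<le> a j / s j * \<bar>?X\<bar>" using as by (rule mult_left_mono)
  moreover have "\<bar>chain_grad n (n * T) s a x j\<bar> = a j / s j * \<bar>?X\<bar>"
    using jd a[of j] s(1)[of j] by (simp add: chain_grad_def abs_mult less_imp_le)
  ultimately show ?thesis using kT unfolding j_def by (metis mult.right_neutral)
qed

text \<open>At value 0 the penalty has slope 0, \<open>dstep\<close> is 0 and \<open>dbump\<close>
  is 1, so the predecessor alone decides the entry.\<close>

lemma chain_grad_at_tail:
  assumes "\<And>m. x (j + m * n) = 0"
  shows "chain_grad n d s a x j = (if j < d then - (a j / s j * step (chain_pre n s x j)) else 0)"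
  using assms[of 0] by (simp add: chain_grad_def dbump_0 dstep_eq_0)

section \<open>Runs with one-bit noise\<close>

definition unif :: "real measure" where
  "unif = uniform_measure lborel {0..1}"

lemma prob_space_unif: "prob_space unif"
  unfolding unif_def by (rule prob_space_uniform_measure) auto

lemma sets_unif [simp, measurable_cong]: "sets unif = sets borel"
  by (simp add: unif_def)

lemma space_unif [simp]: "space unif = UNIV"
  by (simp add: unif_def)

lemma emeasure_unif_atMost:
  assumes "0 \<le> q" "q \<le> 1"
  shows "emeasure unif {..q} = ennreal q"
proof -
  have "{0..1} \<inter> {..q} = {0..q}" using assms by auto
  then show ?thesis using assms by (simp add: unif_def divide_ennreal_def)
qed

lemma indep_vars_PiM_coordinates:
  assumes "\<And>i. i \<in> I \<Longrightarrow> prob_space (M i)" "I \<noteq> {}"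
  shows "prob_space.indep_vars (PiM I M) M (\<lambda>i \<omega>. \<omega> i) I"
proof -
  interpret prob_space "PiM I M" by (rule prob_space_PiM) (rule assms)
  have "distr (PiM I M) (PiM I M) (\<lambda>x. \<lambda>i\<in>I. x i) = distr (PiM I M) (PiM I M) (\<lambda>x. x)"
    by (intro distr_cong) (auto simp: space_PiM PiE_restrict)
  also have "\<dots> = PiM I M" by simp
  also have "\<dots> = PiM I (\<lambda>i. distr (PiM I M) (M i) (\<lambda>\<omega>. \<omega> i))"
    by (intro PiM_cong refl distr_PiM_component[symmetric] assms)
  finally show ?thesis
    using assms by (subst indep_vars_iff_distr_eq_PiM') auto
qed

locale delayed_run =
  fixes n d :: nat and A :: algo and \<tau> p :: "nat \<Rightarrow> real" and H :: "nat \<Rightarrow> vect \<Rightarrow> bool \<Rightarrow> vect"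
  assumes alg_ok: "alg_ok n d A" and zero_respecting: "zero_respecting d A"
    and tau_pos: "\<And>i. i \<in> {1..n} \<Longrightarrow> 0 < \<tau> i"
    and H_vecs: "\<And>i x b. i \<in> {1..n} \<Longrightarrow> x \<in> vecs d \<Longrightarrow> H i x b \<in> vecs d"
    and p_bounds: "\<And>i. 0 \<le> p i" "\<And>i. p i \<le> 1"
begin

text \<open>The uniform sample is read only through a bit that is true with probability
  \<open>p i\<close>, so a step of the run has at most two outcomes.\<close>

definition G :: "nat \<Rightarrow> vect \<Rightarrow> real \<Rightarrow> vect" where
  "G i x \<xi> = H i x (\<xi> \<le> p i)"

abbreviation M :: "(nat \<times> nat \<Rightarrow> real) measure" where
  "M \<equiv> PiM UNIV (\<lambda>_. unif)"

abbreviation R :: "(nat \<times> nat \<Rightarrow> real) \<Rightarrow> nat \<Rightarrow> vect list \<times> (nat \<Rightarrow> ostate)" where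
  "R \<omega> k \<equiv> run A \<tau> G \<omega> k"

abbreviation time :: "(nat \<times> nat \<Rightarrow> real) \<Rightarrow> nat \<Rightarrow> real" where
  "time \<omega> k \<equiv> run_time A \<tau> G \<omega> k"

definition advance :: "vect list \<times> (nat \<Rightarrow> ostate) \<Rightarrow> bool \<Rightarrow> vect list \<times> (nat \<Rightarrow> ostate)" where
  "advance r b =
     (let (gs, s) = r; (t', i, x) = A gs; (s', g) = delayed_oracle (\<tau> i) (H i) t' x (s i) b
      in (gs @ [g], s(i := s')))"

definition asked :: "vect list \<times> (nat \<Rightarrow> ostate) \<Rightarrow> nat" where
  "asked r = fst (snd (A (fst r)))"

text \<open>Read off from the state before the query, hence settled before the bit of that step is
  drawn.\<close>

definition delivers :: "nat \<Rightarrow> vect list \<times> (nat \<Rightarrow> ostate) \<Rightarrow> bool" where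
  "delivers i r \<longleftrightarrow> asked r = i \<and> snd (snd (snd r i)) \<and> fst (snd r i) + \<tau> i \<le> fst (A (fst r))"

lemma run_Suc: "R \<omega> (Suc k) = advance (R \<omega> k) (\<omega> (k, asked (R \<omega> k)) \<le> p (asked (R \<omega> k)))"
  by (auto simp: advance_def asked_def G_def delayed_oracle_def Let_def split: prod.splits)

lemma time_Suc: "time \<omega> (Suc k) = fst (A (fst (R \<omega> k)))"
  by (simp add: run_time_def)

lemma advance_simps:
  assumes r: "snd r (asked r) = (st, sx, sq)"
  shows "advance r b = (if \<not> sq then
       (fst r @ [vzero], (snd r)(asked r := (fst (A (fst r)), snd (snd (A (fst r))), True)))
     else if \<not> delivers (asked r) r then (fst r @ [vzero], snd r)
     else (fst r @ [H (asked r) sx b], (snd r)(asked r := (0, vzero, False))))"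
proof -
  have "(snd r)(asked r := (st, sx, sq)) = snd r" using r by (metis fun_upd_triv)
  then show ?thesis using r
    by (auto simp: advance_def asked_def delivers_def delayed_oracle_def split: prod.splits)
qed

lemma asked_range: "set (fst r) \<subseteq> vecs d \<Longrightarrow> asked r \<in> {1..n}"
  using alg_ok unfolding alg_ok_def asked_def by blast

lemma vzero_vecs: "vzero \<in> vecs d"
  by (simp add: vzero_def vecs_def)

lemma advance_vecs:
  assumes "set (fst r) \<subseteq> vecs d" "\<And>i. fst (snd (snd r i)) \<in> vecs d"
  shows "set (fst (advance r b)) \<subseteq> vecs d" "fst (snd (snd (advance r b) i)) \<in> vecs d"
proof -
  obtain st sx sq where s: "snd r (asked r) = (st, sx, sq)" by (metis surj_pair)
  have "sx \<in> vecs d" using assms(2)[of "asked r"] s by simp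
  moreover have "snd (snd (A (fst r))) \<in> vecs d" using alg_ok assms(1) unfolding alg_ok_def by blast
  ultimately show "set (fst (advance r b)) \<subseteq> vecs d" "fst (snd (snd (advance r b) i)) \<in> vecs d"
    using assms asked_range[OF assms(1)] H_vecs vzero_vecs
    unfolding advance_simps[OF s] by auto
qed

lemma run_vecs: "set (fst (R \<omega> k)) \<subseteq> vecs d" "fst (snd (snd (R \<omega> k) i)) \<in> vecs d"
proof -
  have "set (fst (R \<omega> k)) \<subseteq> vecs d \<and> (\<forall>i. fst (snd (snd (R \<omega> k) i)) \<in> vecs d)"
  proof (induction k)
    case (Suc k)
    then show ?case unfolding run_Suc using advance_vecs by blast
  qed (simp add: vzero_vecs)
  then show "set (fst (R \<omega> k)) \<subseteq> vecs d" "fst (snd (snd (R \<omega> k) i)) \<in> vecs d" by auto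
qed

lemma time_mono: "time \<omega> k \<le> time \<omega> (Suc k)"
proof (cases k)
  case 0
  then show ?thesis using alg_ok run_vecs(1)[of \<omega> 0] unfolding alg_ok_def
    by (auto simp: run_time_def)
next
  case (Suc j)
  obtain st sx sq where s: "snd (R \<omega> j) (asked (R \<omega> j)) = (st, sx, sq)" by (metis surj_pair)
  have "\<exists>g. fst (R \<omega> k) = fst (R \<omega> j) @ [g]"
    unfolding Suc run_Suc advance_simps[OF s] by auto
  then obtain g where g: "fst (R \<omega> k) = fst (R \<omega> j) @ [g]" by blast
  have "set gs \<subseteq> vecs d \<Longrightarrow> gs \<noteq> [] \<Longrightarrow> fst (A (butlast gs)) \<le> fst (A gs)" for gs
    using alg_ok by (simp add: alg_ok_def)
  from this[OF run_vecs(1)[of \<omega> k]] show ?thesis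
    unfolding time_Suc g by (simp add: Suc time_Suc)
qed

lemma time_le: "j \<le> k \<Longrightarrow> time \<omega> j \<le> time \<omega> k"
  by (rule lift_Suc_mono_le[of "time \<omega>"]) (rule time_mono)

text \<open>A delivery comes at least \<open>\<tau> i\<close> after its request, and that request is
  not earlier than the preceding delivery.\<close>

lemma delivery_count:
  fixes \<omega> k
  assumes i: "i \<in> {1..n}"
  defines "N \<equiv> \<lambda>k. \<Sum>l<k. of_bool (delivers i (R \<omega> l))"
  shows "real (N k) * \<tau> i \<le> time \<omega> k"
proof -
  \<comment> \<open>While worker i is busy, the bound has to hold already at the stored request
    time; the next delivery then adds a full \<open>\<tau> i\<close> to it.\<close>
  have "real (N k) * \<tau> i \<le> time \<omega> k \<and> (snd (snd (snd (R \<omega> k) i)) \<longrightarrow> real (N k) * \<tau> i \<le> fst (snd (R \<omega> k) i))"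
  proof (induction k)
    case 0
    then show ?case by (simp add: N_def run_time_def)
  next
    case (Suc k)
    let ?r = "R \<omega> k"
    obtain st sx sq where s: "snd ?r (asked ?r) = (st, sx, sq)" by (metis surj_pair)
    have t: "time \<omega> k \<le> fst (A (fst ?r))" using time_mono[of \<omega> k] by (simp add: time_Suc)
    have N: "N (Suc k) = N k + of_bool (delivers i ?r)" unfolding N_def by (rule sum.lessThan_Suc)
    show ?case
    proof (cases "delivers i ?r")
      case True
      then have "asked ?r = i" "sq" "st + \<tau> i \<le> fst (A (fst ?r))" using s by (auto simp: delivers_def)
      moreover have "real (N k) * \<tau> i \<le> st" using Suc s calculation by auto
      ultimately show ?thesis using True s unfolding N run_Suc time_Suc
        by (simp add: advance_simps algebra_simps)
    next
      case False
      then show ?thesis using Suc t s unfolding N run_Suc time_Suc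
        by (cases "asked ?r = i") (auto simp: advance_simps)
    qed
  qed
  then show ?thesis by simp
qed

text \<open>The cutoff at t makes the bound uniform in k, so that it passes to the infinite series
  over all steps.\<close>

lemma timely_delivery_count:
  assumes i: "i \<in> {1..n}" and t: "0 \<le> t"
  shows "(\<Sum>l<k. of_bool (delivers i (R \<omega> l) \<and> time \<omega> (Suc l) \<le> t)) * \<tau> i \<le> t"
proof (induction k)
  case (Suc k)
  show ?case
  proof (cases "time \<omega> (Suc k) \<le> t")
    case True
    have "(\<Sum>l<Suc k. of_bool (delivers i (R \<omega> l) \<and> time \<omega> (Suc l) \<le> t))
      \<le> real (\<Sum>l<Suc k. of_bool (delivers i (R \<omega> l)))"
      unfolding of_nat_sum by (intro sum_mono) auto
    then have "(\<Sum>l<Suc k. of_bool (delivers i (R \<omega> l) \<and> time \<omega> (Suc l) \<le> t)) * \<tau> i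
      \<le> real (\<Sum>l<Suc k. of_bool (delivers i (R \<omega> l))) * \<tau> i"
      using tau_pos[OF i] by (intro mult_right_mono) auto
    then show ?thesis using delivery_count[OF i, of \<omega> "Suc k"] True by linarith
  qed (use Suc in simp)
qed (use t in simp)

text \<open>The sets Z m are to be thought of as the coordinates of worker i from chain position m on:
  x vanishing there can be left only through a successful delivery, and only by one position.\<close>

lemma progress:
  fixes Z :: "nat \<Rightarrow> nat set"
  assumes i: "i \<in> {1..n}" and Z: "\<And>m m'. m \<le> m' \<Longrightarrow> Z m' \<subseteq> Z m"
    and other: "\<And>i' x b j. i' \<in> {1..n} \<Longrightarrow> i' \<noteq> i \<Longrightarrow> j \<in> Z 0 \<Longrightarrow> H i' x b j = 0"
    and step: "\<And>x b m j. (\<And>j. j \<in> Z m \<Longrightarrow> x j = 0) \<Longrightarrow> j \<in> Z (m + of_bool b) \<Longrightarrow> H i x b j = 0"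
  defines "N \<equiv> \<lambda>\<omega> k. \<Sum>l<k. of_bool (delivers i (R \<omega> l) \<and> \<omega> (l, i) \<le> p i)"
  assumes j: "j \<in> Z (N \<omega> k)"
  shows "run_point A \<tau> G \<omega> k j = 0"
proof -
  have zr: "snd (snd (A gs)) j = 0" if "set gs \<subseteq> vecs d" "\<And>g. g \<in> set gs \<Longrightarrow> g j = 0" for gs j
    using zero_respecting that unfolding zero_respecting_def supp_def by blast
  \<comment> \<open>The gradient is taken at the point stored with the request, not at the current
    one, so the invariant must cover the stored point of worker i as well as all returned
    vectors.\<close>
  have "(\<forall>g\<in>set (fst (R \<omega> k)). \<forall>j\<in>Z (N \<omega> k). g j = 0) \<and> (\<forall>j\<in>Z (N \<omega> k). fst (snd (snd (R \<omega> k) i)) j = 0)"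
  proof (induction k)
    case 0
    then show ?case by (simp add: vzero_def)
  next
    case (Suc k)
    let ?r = "R \<omega> k"
    let ?b = "\<omega> (k, asked ?r) \<le> p (asked ?r)"
    obtain st sx sq where s: "snd ?r (asked ?r) = (st, sx, sq)" by (metis surj_pair)
    have N: "N \<omega> (Suc k) = N \<omega> k + of_bool (delivers i ?r \<and> \<omega> (k, i) \<le> p i)"
      unfolding N_def by (rule sum.lessThan_Suc)
    then have sub: "Z (N \<omega> (Suc k)) \<subseteq> Z (N \<omega> k)" "Z (N \<omega> (Suc k)) \<subseteq> Z 0" using Z by simp_all
    have old: "g j = 0" if "g \<in> set (fst ?r)" "j \<in> Z (N \<omega> (Suc k))" for g j
      using Suc that sub by blast
    have old_state: "fst (snd (snd ?r i)) j = 0" if "j \<in> Z (N \<omega> (Suc k))" for j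
      using Suc that sub by blast
    have new: "snd (snd (A (fst ?r))) j = 0" if "j \<in> Z (N \<omega> (Suc k))" for j
      using old that run_vecs by (intro zr) auto
    have ask: "asked ?r \<in> {1..n}" using asked_range run_vecs by blast
    have grad: "H (asked ?r) sx ?b j = 0" if "delivers (asked ?r) ?r" "j \<in> Z (N \<omega> (Suc k))" for j
    proof (cases "asked ?r = i")
      case True
      have "H i sx ?b j = 0"
      proof (rule step)
        show "sx j = 0" if "j \<in> Z (N \<omega> k)" for j using Suc that s True by auto
        show "j \<in> Z (N \<omega> k + of_bool ?b)" using that True by (simp add: N)
      qed
      then show ?thesis using True by simp
    qed (use that sub other ask in auto)
    show ?case unfolding run_Suc advance_simps[OF s]
      using old old_state new grad by (auto simp: vzero_def)
  qed
  then show ?thesis using j unfolding run_point_def by (intro zr run_vecs(1)) auto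
qed

section \<open>Measurability of the run and independence of its next bit\<close>

lemma run_cong: "(\<And>l i. l < k \<Longrightarrow> \<omega> (l, i) = \<omega>' (l, i)) \<Longrightarrow> R \<omega> k = R \<omega>' k"
proof (induction k)
  case (Suc k)
  then have "R \<omega> k = R \<omega>' k" by simp
  then show ?case using Suc.prems[of k] unfolding run_Suc by simp
qed simp

text \<open>The algorithm is an arbitrary function, but each step branches on one bit, so k steps
  reach finitely many states and every predicate of the state is measurable. The index set J is left
  open to cover both the full product and its part of samples before step k.\<close>

lemma measurable_run:
  "\<exists>S. finite S \<and> (\<forall>J. {..<k} \<times> UNIV \<subseteq> J \<longrightarrow> (\<lambda>\<omega>. R \<omega> k) \<in> PiM J (\<lambda>_. unif) \<rightarrow>\<^sub>M count_space S)"
proof (induction k)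
  case 0
  then show ?case by (intro exI[of _ "{R undefined 0}"]) simp
next
  case (Suc k)
  then obtain S where S: "finite S"
    and m: "\<And>J. {..<k} \<times> UNIV \<subseteq> J \<Longrightarrow> (\<lambda>\<omega>. R \<omega> k) \<in> PiM J (\<lambda>_. unif) \<rightarrow>\<^sub>M count_space S" by blast
  let ?S = "case_prod advance ` (S \<times> UNIV)"
  have "(\<lambda>\<omega>. R \<omega> (Suc k)) \<in> PiM J (\<lambda>_. unif) \<rightarrow>\<^sub>M count_space ?S" if J: "{..<Suc k} \<times> UNIV \<subseteq> J" for J
    unfolding run_Suc
  proof (rule measurable_compose_countable'[where I = S and g = "\<lambda>\<omega>. R \<omega> k"
        and f = "\<lambda>r \<omega>. advance r (\<omega> (k, asked r) \<le> p (asked r))"])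
    show "(\<lambda>\<omega>. R \<omega> k) \<in> PiM J (\<lambda>_. unif) \<rightarrow>\<^sub>M count_space S"
      using J by (intro m) fastforce
    fix r assume r: "r \<in> S"
    have "(k, asked r) \<in> J" using J by auto
    then have "(\<lambda>\<omega>. \<omega> (k, asked r) \<le> p (asked r)) \<in> PiM J (\<lambda>_. unif) \<rightarrow>\<^sub>M count_space UNIV"
      by measurable
    moreover have "advance r \<in> count_space UNIV \<rightarrow>\<^sub>M count_space ?S"
      using r by (auto simp: measurable_count_space_eq1)
    ultimately show "(\<lambda>\<omega>. advance r (\<omega> (k, asked r) \<le> p (asked r))) \<in> PiM J (\<lambda>_. unif) \<rightarrow>\<^sub>M count_space ?S"
      by (rule measurable_compose)
  qed (simp add: S countable_finite)
  moreover have "finite ?S" using S by simp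
  ultimately show ?case by blast
qed

lemma measurable_run_pred:
  assumes "{..<k} \<times> UNIV \<subseteq> J"
  shows "(\<lambda>\<omega>. P (R \<omega> k)) \<in> PiM J (\<lambda>_. unif) \<rightarrow>\<^sub>M count_space (UNIV :: bool set)"
proof -
  obtain S where "(\<lambda>\<omega>. R \<omega> k) \<in> PiM J (\<lambda>_. unif) \<rightarrow>\<^sub>M count_space S"
    using measurable_run assms by blast
  then show ?thesis by (rule measurable_compose) simp
qed

sublocale prob_space M
  by (rule prob_space_PiM) (rule prob_space_unif)

text \<open>The first k steps read only samples of index below k, so by \<open>run_cong\<close> the
  event factors through a restriction that is independent of the sample at (k, i).\<close>

lemma prob_run_and_bit:
  "prob {\<omega>. P (R \<omega> k) \<and> \<omega> (k, i) \<le> p i} = p i * prob {\<omega>. P (R \<omega> k)}"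
proof -
  let ?J = "{..<k} \<times> UNIV" and ?K = "{(k, i)}"
  let ?F = "\<lambda>\<omega>. P (R \<omega> k)" and ?B = "\<lambda>\<omega> :: nat \<times> nat \<Rightarrow> real. \<omega> (k, i) \<le> p i"
  have "indep_vars (\<lambda>_. unif) (\<lambda>i \<omega>. \<omega> i) UNIV"
    using indep_vars_PiM_coordinates[of UNIV "\<lambda>_. unif"] prob_space_unif by simp
  then have "indep_var (PiM ?J (\<lambda>_. unif)) (\<lambda>\<omega>. restrict \<omega> ?J) (PiM ?K (\<lambda>_. unif)) (\<lambda>\<omega>. restrict \<omega> ?K)"
    using indep_var_restrict[of "\<lambda>_. unif" "\<lambda>i \<omega>. \<omega> i" UNIV ?J ?K] by auto
  moreover have "?F \<in> PiM ?J (\<lambda>_. unif) \<rightarrow>\<^sub>M count_space UNIV" by (rule measurable_run_pred) simp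
  moreover have "?B \<in> PiM ?K (\<lambda>_. unif) \<rightarrow>\<^sub>M count_space UNIV" by measurable
  ultimately have "indep_var (count_space UNIV) (?F \<circ> (\<lambda>\<omega>. restrict \<omega> ?J)) (count_space UNIV) (?B \<circ> (\<lambda>\<omega>. restrict \<omega> ?K))"
    by (rule indep_var_compose)
  moreover have "?F \<circ> (\<lambda>\<omega>. restrict \<omega> ?J) = ?F" by (rule ext) (auto intro!: arg_cong[where f = P] run_cong)
  moreover have "?B \<circ> (\<lambda>\<omega>. restrict \<omega> ?K) = ?B" by (rule ext) simp
  ultimately have "indep_var (count_space UNIV) ?F (count_space UNIV) ?B" by simp
  from indep_varD[OF this, of "{True}" "{True}"]
  have "prob {\<omega>. P (R \<omega> k) \<and> \<omega> (k, i) \<le> p i} = prob {\<omega>. P (R \<omega> k)} * prob {\<omega>. \<omega> (k, i) \<le> p i}"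
    by (simp add: vimage_def space_PiM)
  moreover have "prob {\<omega>. \<omega> (k, i) \<le> p i} = p i"
  proof -
    have "emeasure unif {..p i} = emeasure (distr M unif (\<lambda>\<omega>. \<omega> (k, i))) {..p i}"
      by (subst distr_PiM_component) (auto simp: prob_space_unif)
    also have "\<dots> = emeasure M {\<omega>. \<omega> (k, i) \<le> p i}"
      by (subst emeasure_distr) (auto simp: vimage_def space_PiM)
    finally have "emeasure M {\<omega>. \<omega> (k, i) \<le> p i} = ennreal (p i)"
      using p_bounds emeasure_unif_atMost[of "p i"] by simp
    then show ?thesis using p_bounds by (simp add: measure_def)
  qed
  ultimately show ?thesis by simp
qed

text \<open>An infinite series, because the number of queries before time t is unbounded; its values
  are therefore taken in \<open>ennreal\<close>.\<close>

definition successes :: "nat \<Rightarrow> real \<Rightarrow> (nat \<times> nat \<Rightarrow> real) \<Rightarrow> ennreal" where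
  "successes i t \<omega> = (\<Sum>l. of_bool ((delivers i (R \<omega> l) \<and> time \<omega> (Suc l) \<le> t) \<and> \<omega> (l, i) \<le> p i))"

lemma measurable_pred_sets:
  "(\<lambda>\<omega>. P \<omega>) \<in> M \<rightarrow>\<^sub>M count_space (UNIV :: bool set) \<Longrightarrow> {\<omega>. P \<omega>} \<in> sets M"
  by (simp add: pred_def space_PiM)

lemma nn_integral_of_bool:
  "{\<omega>. P \<omega>} \<in> sets M \<Longrightarrow> (\<integral>\<^sup>+\<omega>. of_bool (P \<omega>) \<partial>M) = ennreal (prob {\<omega>. P \<omega>})"
  using nn_integral_indicator[of "{\<omega>. P \<omega>}" M] by (simp add: indicator_def emeasure_eq_measure)

lemma successes_measurable [measurable]: "successes i t \<in> borel_measurable M"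
proof -
  have [measurable]: "(\<lambda>\<omega>. delivers i (R \<omega> l) \<and> fst (A (fst (R \<omega> l))) \<le> t) \<in> M \<rightarrow>\<^sub>M count_space UNIV" for l
    by (rule measurable_run_pred) simp
  show ?thesis unfolding successes_def[abs_def] time_Suc of_bool_def by measurable
qed

text \<open>A Wald-type argument: each summand contributes \<open>p i\<close> times the probability
  of a timely delivery. With the series moved back inside the integral, the pathwise bound on
  deliveries applies.\<close>

lemma expected_successes:
  assumes i: "i \<in> {1..n}" and t: "0 \<le> t"
  shows "(\<integral>\<^sup>+\<omega>. successes i t \<omega> \<partial>M) \<le> ennreal (p i * (t / \<tau> i))"
proof -
  let ?P = "\<lambda>r. delivers i r \<and> fst (A (fst r)) \<le> t"
  have [measurable]: "(\<lambda>\<omega>. ?P (R \<omega> l)) \<in> M \<rightarrow>\<^sub>M count_space UNIV" for l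
    by (rule measurable_run_pred) simp
  have B: "(\<lambda>\<omega>. ?P (R \<omega> l) \<and> \<omega> (l, i) \<le> p i) \<in> M \<rightarrow>\<^sub>M count_space UNIV" for l by measurable
  have "(\<integral>\<^sup>+\<omega>. successes i t \<omega> \<partial>M) = (\<Sum>l. \<integral>\<^sup>+\<omega>. of_bool (?P (R \<omega> l) \<and> \<omega> (l, i) \<le> p i) \<partial>M)"
    unfolding successes_def time_Suc by (rule nn_integral_suminf) (use B in \<open>simp add: of_bool_def\<close>)
  also have "\<dots> = (\<Sum>l. ennreal (p i) * (\<integral>\<^sup>+\<omega>. of_bool (?P (R \<omega> l)) \<partial>M))"
  proof (intro suminf_cong)
    fix l
    show "(\<integral>\<^sup>+\<omega>. of_bool (?P (R \<omega> l) \<and> \<omega> (l, i) \<le> p i) \<partial>M) = ennreal (p i) * (\<integral>\<^sup>+\<omega>. of_bool (?P (R \<omega> l)) \<partial>M)"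
      unfolding nn_integral_of_bool[OF measurable_pred_sets[OF B]]
        nn_integral_of_bool[OF measurable_pred_sets[OF measurable_run_pred[of l UNIV ?P, OF subset_UNIV]]]
        prob_run_and_bit[of ?P] by (rule ennreal_mult) (simp_all add: p_bounds)
  qed
  also have "\<dots> = ennreal (p i) * (\<integral>\<^sup>+\<omega>. (\<Sum>l. of_bool (?P (R \<omega> l))) \<partial>M)"
    by (simp add: nn_integral_suminf of_bool_def)
  also have "\<dots> \<le> ennreal (p i) * (\<integral>\<^sup>+\<omega>. ennreal (t / \<tau> i) \<partial>M)"
  proof (intro mult_left_mono nn_integral_mono suminf_le_const summableI)
    fix \<omega> k
    have "(\<Sum>l<k. of_bool (?P (R \<omega> l))) \<le> t / \<tau> i"
      using timely_delivery_count[OF i t, of \<omega> k] tau_pos[OF i] by (simp add: time_Suc field_simps)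
    then have "ennreal (\<Sum>l<k. of_bool (?P (R \<omega> l))) \<le> ennreal (t / \<tau> i)" by (rule ennreal_leI)
    also have "ennreal (\<Sum>l<k. of_bool (?P (R \<omega> l))) = (\<Sum>l<k. ennreal (of_bool (?P (R \<omega> l))))"
      by (rule sum_ennreal[symmetric]) simp
    also have "\<dots> = (\<Sum>l<k. of_bool (?P (R \<omega> l)))" by (intro sum.cong) auto
    finally show "(\<Sum>l<k. of_bool (?P (R \<omega> l))) \<le> ennreal (t / \<tau> i)" .
  qed simp
  also have "\<dots> = ennreal (p i * (t / \<tau> i))"
    using p_bounds t tau_pos[OF i] by (simp add: emeasure_space_1 ennreal_mult[symmetric] less_imp_le)
  finally show ?thesis .
qed

lemma prob_few_successes:
  assumes i: "i \<in> {1..n}" and t: "0 \<le> t" and T: "0 < T" and small: "p i * t \<le> \<tau> i * T / 4"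
  shows "3 / 4 \<le> prob {\<omega>. successes i t \<omega> < ennreal T}"
proof -
  have "ennreal T * emeasure M {\<omega> \<in> space M. ennreal T \<le> successes i t \<omega>} \<le> (\<integral>\<^sup>+\<omega>. successes i t \<omega> \<partial>M)"
  proof -
    have "ennreal T * emeasure M {\<omega> \<in> space M. ennreal T \<le> successes i t \<omega>}
      = (\<integral>\<^sup>+\<omega>. ennreal T * indicator {\<omega> \<in> space M. ennreal T \<le> successes i t \<omega>} \<omega> \<partial>M)"
      by (rule nn_integral_cmult_indicator[symmetric]) measurable
    also have "\<dots> \<le> (\<integral>\<^sup>+\<omega>. successes i t \<omega> \<partial>M)"
      by (rule nn_integral_mono) (auto simp: indicator_def)
    finally show ?thesis .
  qed
  also have "\<dots> \<le> ennreal (p i * (t / \<tau> i))" by (rule expected_successes[OF i t])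
  also have "\<dots> \<le> ennreal (T * (1 / 4))"
    using small tau_pos[OF i] by (intro ennreal_leI) (simp add: field_simps)
  finally have "T * prob {\<omega> \<in> space M. ennreal T \<le> successes i t \<omega>} \<le> T * (1 / 4)"
    using T by (simp add: emeasure_eq_measure ennreal_mult[symmetric])
  then have "prob {\<omega> \<in> space M. ennreal T \<le> successes i t \<omega>} \<le> 1 / 4"
    using T by simp
  moreover have "{\<omega>. successes i t \<omega> < ennreal T} = space M - {\<omega> \<in> space M. ennreal T \<le> successes i t \<omega>}"
    by (auto simp: space_PiM)
  moreover have "prob (space M - {\<omega> \<in> space M. ennreal T \<le> successes i t \<omega>})
      = 1 - prob {\<omega> \<in> space M. ennreal T \<le> successes i t \<omega>}"
    by (rule prob_compl) measurable
  ultimately show ?thesis by simp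
qed

text \<open>The point at index k depends on answers 1 to k, that is on steps l < k, and these happen
  at times \<open>time \<omega> (Suc l)\<close>, none later than
  \<open>time \<omega> k\<close>.\<close>

lemma successes_ge:
  assumes "time \<omega> k \<le> t"
  shows "of_nat (\<Sum>l<k. of_bool (delivers i (R \<omega> l) \<and> \<omega> (l, i) \<le> p i)) \<le> successes i t \<omega>"
proof -
  have "of_nat (\<Sum>l<k. of_bool (delivers i (R \<omega> l) \<and> \<omega> (l, i) \<le> p i))
    = (\<Sum>l<k. of_bool ((delivers i (R \<omega> l) \<and> time \<omega> (Suc l) \<le> t) \<and> \<omega> (l, i) \<le> p i) :: ennreal)"
    unfolding of_nat_sum
  proof (intro sum.cong refl)
    fix l assume "l \<in> {..<k}"
    then have "time \<omega> (Suc l) \<le> t" using assms time_le[of "Suc l" k \<omega>] by auto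
    then show "of_nat (of_bool (delivers i (R \<omega> l) \<and> \<omega> (l, i) \<le> p i))
      = (of_bool ((delivers i (R \<omega> l) \<and> time \<omega> (Suc l) \<le> t) \<and> \<omega> (l, i) \<le> p i) :: ennreal)" by simp
  qed
  also have "\<dots> \<le> successes i t \<omega>" unfolding successes_def by (rule sum_le_suminf) auto
  finally show ?thesis .
qed

end

section \<open>The hard instance\<close>

lemma chain_grad_weight: "chain_grad n d s a x j = a j * chain_grad n d s (\<lambda>_. 1) x j"
  by (simp add: chain_grad_def)

text \<open>Of two tail coordinates in one block the later has predecessor value 0, so its
  \<open>step\<close> factor kills the entry. At most one entry survives, and its size is at most
  \<open>a j / s j\<close>.\<close>

lemma chain_grad_tail_sum:
  assumes block: "\<And>j. j mod n \<noteq> b \<Longrightarrow> a j = 0" and K: "\<And>j. (a j / s j)\<^sup>2 \<le> K"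
  shows "(\<Sum>j\<in>{j. j < d \<and> (\<forall>m. x (j + m * n) = 0)}. (chain_grad n d s a x j)\<^sup>2) \<le> K"
proof -
  let ?g = "chain_grad n d s a x"
  define S where "S = {j. j < d \<and> (\<forall>m. x (j + m * n) = 0) \<and> ?g j \<noteq> 0}"
  have absurd: False if S: "j \<in> S" "j' \<in> S" and less: "j < j'" for j j'
  proof -
    have "a j \<noteq> 0" "a j' \<noteq> 0" using S by (auto simp: S_def chain_grad_def)
    then have "j mod n = j' mod n" using block by metis
    then obtain m where m: "j' = j + m * n"
      using less by (metis less_imp_le mod_eq_nat2E mult.commute)
    then obtain k where k: "m = Suc k" using less by (cases m) auto
    have "j' - n = j + k * n" "\<not> j' < n" using m k by auto
    moreover have "x (j + k * n) = 0" using S(1) by (simp add: S_def)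
    ultimately have "chain_pre n s x j' = 0" by (simp add: chain_pre_def)
    then have "?g j' = 0"
      using S(2) by (subst chain_grad_at_tail) (auto simp: S_def step_eq_0)
    then show False using S(2) by (simp add: S_def)
  qed
  have "(\<Sum>j\<in>{j. j < d \<and> (\<forall>m. x (j + m * n) = 0)}. (?g j)\<^sup>2) = (\<Sum>j\<in>S. (?g j)\<^sup>2)"
    by (intro sum.mono_neutral_right) (auto simp: S_def)
  also have "\<dots> \<le> K"
  proof (cases "S = {}")
    case True
    then show ?thesis using order_trans[OF zero_le_power2 K] by simp
  next
    case False
    then obtain j where j: "j \<in> S" by auto
    then have S: "S = {j}" using absurd by (metis insertI1 linorder_neqE_nat subsetI subset_singletonD insert_absorb empty_iff)
    have "(?g j)\<^sup>2 = (a j / s j)\<^sup>2 * (step (chain_pre n s x j))\<^sup>2"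
      using j by (subst chain_grad_at_tail) (auto simp: S_def power_mult_distrib power_divide)
    also have "\<dots> \<le> (a j / s j)\<^sup>2 * 1"
      using step_bounds[of "chain_pre n s x j"] by (intro mult_left_mono power_le_one) auto
    finally show ?thesis using S K[of j] by simp
  qed
  finally show ?thesis .
qed

lemma unif_bit_integral:
  assumes "0 \<le> q" "q \<le> 1"
  shows "integrable unif (\<lambda>\<xi>. of_bool (\<xi> \<le> q) :: real)" "(\<integral>\<xi>. of_bool (\<xi> \<le> q) \<partial>unif) = q"
proof -
  have e: "(\<lambda>\<xi>. of_bool (\<xi> \<le> q) :: real) = indicator {..q}" by (auto simp: indicator_def)
  show "integrable unif (\<lambda>\<xi>. of_bool (\<xi> \<le> q) :: real)" "(\<integral>\<xi>. of_bool (\<xi> \<le> q) \<partial>unif) = q"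
    unfolding e using emeasure_unif_atMost[OF assms] assms by (auto simp: measure_def)
qed

lemma unif_bit_affine:
  assumes "0 \<le> q" "q \<le> 1"
  shows "integrable unif (\<lambda>\<xi>. u + v * of_bool (\<xi> \<le> q) :: real)"
    "(\<integral>\<xi>. u + v * of_bool (\<xi> \<le> q) \<partial>unif) = u + v * q"
proof -
  interpret prob_space unif by (rule prob_space_unif)
  show "integrable unif (\<lambda>\<xi>. u + v * of_bool (\<xi> \<le> q) :: real)"
    "(\<integral>\<xi>. u + v * of_bool (\<xi> \<le> q) \<partial>unif) = u + v * q"
    using unif_bit_integral[OF assms] by (simp_all add: prob_space[simplified])
qed

text \<open>Only coordinates at which the rest of their chain vanishes are randomised; among these at most
  one has a nonzero gradient.\<close>

definition masked :: "nat \<Rightarrow> real \<Rightarrow> vect \<Rightarrow> vect \<Rightarrow> bool \<Rightarrow> vect" where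
  "masked n q g x b j = g j * (if \<forall>m. x (j + m * n) = 0 then of_bool b / q else 1)"

lemma masked_in_vecs: "g \<in> vecs d \<Longrightarrow> masked n q g x b \<in> vecs d"
  by (simp add: masked_def vecs_def)

lemma masked_mean:
  assumes "0 < q" "q \<le> 1"
  shows "integrable unif (\<lambda>\<xi>. masked n q g x (\<xi> \<le> q) j)" "(\<integral>\<xi>. masked n q g x (\<xi> \<le> q) j \<partial>unif) = g j"
proof -
  let ?t = "\<forall>m. x (j + m * n) = 0"
  have e: "masked n q g x (\<xi> \<le> q) j = (if ?t then 0 else g j) + (if ?t then g j / q else 0) * of_bool (\<xi> \<le> q)" for \<xi>
    by (simp add: masked_def)
  show "integrable unif (\<lambda>\<xi>. masked n q g x (\<xi> \<le> q) j)" "(\<integral>\<xi>. masked n q g x (\<xi> \<le> q) j \<partial>unif) = g j"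
    unfolding e using assms unif_bit_affine[of q] by auto
qed

text \<open>The relative error of a masked entry is b/q - 1 with mean square 1/q - 1, so the
  variance is at most K (1/q - 1): it is 0 for q = 1 and at most K/q otherwise.\<close>

lemma masked_variance:
  assumes q: "0 < q" "q \<le> 1" and v: "q = 1 \<or> K \<le> v * q" and v0: "0 \<le> v" and K0: "0 \<le> K"
    and K: "(\<Sum>j\<in>{j. j < d \<and> (\<forall>m. x (j + m * n) = 0)}. (g j)\<^sup>2) \<le> K"
  shows "(\<integral>\<^sup>+\<xi>. ennreal ((norm_d d (vdiff (masked n q g x (\<xi> \<le> q)) g))\<^sup>2) \<partial>unif) \<le> ennreal v"
proof -
  have "(norm_d d (vdiff (masked n q g x b) g))\<^sup>2 \<le> K + K * (1 / q\<^sup>2 - 2 / q) * of_bool b" for b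
  proof -
    have "(norm_d d (vdiff (masked n q g x b) g))\<^sup>2
      = (\<Sum>j<d. if \<forall>m. x (j + m * n) = 0 then (g j)\<^sup>2 * (of_bool b / q - 1)\<^sup>2 else 0)"
      unfolding norm_d_power2
      by (intro sum.cong refl) (simp add: vdiff_def masked_def power2_eq_square algebra_simps)
    also have "\<dots> = (\<Sum>j\<in>{j. j < d \<and> (\<forall>m. x (j + m * n) = 0)}. (g j)\<^sup>2 * (of_bool b / q - 1)\<^sup>2)"
      by (intro sum.mono_neutral_cong_right) auto
    also have "\<dots> \<le> K * (of_bool b / q - 1)\<^sup>2"
      unfolding sum_distrib_right[symmetric] by (intro mult_right_mono K) simp
    \<comment> \<open>A bit equals its own square, so the squared error is affine in it and only the
      mean of the bit is required.\<close>
    also have "\<dots> = K + K * (1 / q\<^sup>2 - 2 / q) * of_bool b"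
      using q by (cases b) (simp_all add: power2_eq_square field_simps)
    finally show ?thesis .
  qed
  note pt = this
  let ?h = "\<lambda>\<xi>. K + K * (1 / q\<^sup>2 - 2 / q) * of_bool (\<xi> \<le> q)"
  have h0: "0 \<le> ?h \<xi>" for \<xi> by (rule order_trans[OF zero_le_power2 pt])
  have "(\<integral>\<^sup>+\<xi>. ennreal ((norm_d d (vdiff (masked n q g x (\<xi> \<le> q)) g))\<^sup>2) \<partial>unif) \<le> (\<integral>\<^sup>+\<xi>. ennreal (?h \<xi>) \<partial>unif)"
    by (intro nn_integral_mono ennreal_leI pt)
  also have "\<dots> = ennreal (K + K * (1 / q\<^sup>2 - 2 / q) * q)"
    using unif_bit_affine[of q K "K * (1 / q\<^sup>2 - 2 / q)"] q h0
    by (subst nn_integral_eq_integral) auto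
  also have "\<dots> \<le> ennreal v"
  proof (rule ennreal_leI)
    have e: "K + K * (1 / q\<^sup>2 - 2 / q) * q = K / q - K"
      using q by (simp add: power2_eq_square field_simps)
    show "K + K * (1 / q\<^sup>2 - 2 / q) * q \<le> v"
      using v
    proof
      assume "K \<le> v * q"
      then have "K / q \<le> v" using q by (simp add: field_simps)
      then show ?thesis unfolding e using K0 by linarith
    qed (use v0 in simp)
  qed
  finally show ?thesis .
qed

text \<open>Linearity handles the events in any joint distribution. The infimum over k enters as F,
  through monotonicity of the integral alone.\<close>

lemma nn_integral_weighted_events:
  assumes P: "prob_space M" "finite I" and w: "\<And>i. i \<in> I \<Longrightarrow> 0 \<le> w i"
    and E: "\<And>i. i \<in> I \<Longrightarrow> E i \<in> sets M" "\<And>i. i \<in> I \<Longrightarrow> q \<le> measure M (E i)"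
    and F: "\<And>\<omega>. ennreal (\<Sum>i\<in>I. w i * indicator (E i) \<omega>) \<le> F \<omega>"
  shows "ennreal (q * (\<Sum>i\<in>I. w i)) \<le> (\<integral>\<^sup>+\<omega>. F \<omega> \<partial>M)"
proof -
  interpret prob_space M by fact
  have "q * (\<Sum>i\<in>I. w i) \<le> (\<Sum>i\<in>I. w i * prob (E i))"
    unfolding sum_distrib_left using w E by (intro sum_mono) (metis mult.commute mult_left_mono)
  then have "ennreal (q * (\<Sum>i\<in>I. w i)) \<le> ennreal (\<integral>\<omega>. (\<Sum>i\<in>I. w i * indicator (E i) \<omega>) \<partial>M)"
    using E by (intro ennreal_leI) (simp add: less_top[symmetric])
  also have "\<dots> = (\<integral>\<^sup>+\<omega>. ennreal (\<Sum>i\<in>I. w i * indicator (E i) \<omega>) \<partial>M)"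
    using w E by (intro nn_integral_eq_integral[symmetric]) (auto intro!: sum_nonneg simp: less_top[symmetric])
  also have "\<dots> \<le> (\<integral>\<^sup>+\<omega>. F \<omega> \<partial>M)" by (intro nn_integral_mono F)
  finally show ?thesis .
qed

text \<open>Weights, probabilities and the set I of workers whose unfinished blocks are counted stay
  free, so that one construction serves both terms of the time bound.\<close>

lemma hard_instance:
  fixes n T :: nat and \<sigma>2 L \<Delta> \<epsilon> t :: real and \<tau> w p :: "nat \<Rightarrow> real" and A :: algo
  defines "d \<equiv> n * T"
  assumes n: "n \<ge> 1" and \<sigma>2: "\<sigma>2 > 0" and \<tau>: "\<And>i. i \<in> {1..n} \<Longrightarrow> 0 < \<tau> i" and L: "L > 0" and \<epsilon>: "\<epsilon> > 0"
    and T: "T \<ge> 1" "180 * \<epsilon> * T \<le> L * \<Delta>"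
    and w: "\<And>i. i \<in> {1..n} \<Longrightarrow> 0 < w i" "(\<Sum>i=1..n. w i) = 1"
    and p: "\<And>i. 0 < p i" "\<And>i. p i \<le> 1"
    and var: "\<And>i. i \<in> {1..n} \<Longrightarrow> p i = 1 \<or> 4 * (real n)\<^sup>2 * \<epsilon> * w i \<le> \<sigma>2 * p i"
    and I: "I \<subseteq> {1..n}" "1 / 2 \<le> (\<Sum>i\<in>I. w i)"
    and t: "0 \<le> t" "\<And>i. i \<in> I \<Longrightarrow> p i * t \<le> \<tau> i * T / 4"
    and A: "alg_ok n d A" "zero_respecting d A"
  shows "\<exists>(f::nat \<Rightarrow> vect \<Rightarrow> real) (gf::nat \<Rightarrow> vect \<Rightarrow> vect)
             (D::nat \<Rightarrow> real measure) (G::nat \<Rightarrow> vect \<Rightarrow> real \<Rightarrow> vect).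
         (\<forall>i\<in>{1..n}. \<forall>x\<in>vecs d. has_grad d (f i) (gf i x) x) \<and>
         in_F d \<Delta> L (\<lambda>x. (1 / real n) * (\<Sum>i=1..n. f i x))
                     (\<lambda>x j. (1 / real n) * (\<Sum>i=1..n. gf i x j)) \<and>
         admissible_oracles n d \<sigma>2 gf D G \<and>
         (\<integral>\<^sup>+\<omega>. (INF k\<in>{k. run_time A \<tau> G \<omega> k \<le> t}.
              ennreal ((norm_d d (\<lambda>j. (1 / real n) * (\<Sum>i=1..n. gf i (run_point A \<tau> G \<omega> k) j)))\<^sup>2))
            \<partial>(PiM (UNIV :: (nat \<times> nat) set) (\<lambda>(k, i). D i))) > ennreal \<epsilon>"
proof -
  define blk where "blk j = j mod n + 1" for j
  have blk: "blk j \<in> {1..n}" for j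
  proof -
    have "j mod n < n" using n by simp
    then show ?thesis by (simp add: blk_def)
  qed
  have blk_at: "blk (i - 1 + m * n) = i" "(i - 1 + m * n) div n = m" if i: "i \<in> {1..n}" for i m
  proof -
    have "i - 1 < n" using i by auto
    then show "(i - 1 + m * n) div n = m" by (simp add: div_mult_self1)
    have mod: "(i - 1 + m * n) mod n = i - 1" using \<open>i - 1 < n\<close> by (simp only: mod_mult_self1 mod_less)
    then show "blk (i - 1 + m * n) = i" unfolding blk_def mod using i by simp
  qed
  \<comment> \<open>Chosen so that a squared entry \<open>(a j / s j)\<^sup>2\<close> is 4
    \<open>\<epsilon>\<close> w, while \<open>a j\<close> is 80 \<open>\<epsilon>\<close> w / L.
    Summed over all coordinates the latter bounds the gap by 9/4 * 80 \<open>\<epsilon>\<close> T /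
    L = 180 \<open>\<epsilon>\<close> T / L.\<close>
  define s a where "s j = 40 * sqrt (\<epsilon> * w (blk j)) / L" and "a j = L * (s j)\<^sup>2 / 20" for j
  have s: "s j > 0" for j using w(1)[OF blk] \<epsilon> L by (simp add: s_def)
  have per: "s (j + n) = s j" "a (j + n) = a j" for j by (simp_all add: a_def s_def blk_def)
  have a0: "a j \<ge> 0" for j using L by (simp add: a_def)
  have a_eq: "a j = 80 * \<epsilon> / L * w (blk j)" for j
    using w(1)[OF blk, of j] \<epsilon> L by (simp add: a_def s_def power_mult_distrib power_divide power2_eq_square)
  have as: "(a j / s j)\<^sup>2 = 4 * \<epsilon> * w (blk j)" "a j / s j = 2 * sqrt (\<epsilon> * w (blk j))" for j
  proof -
    show "a j / s j = 2 * sqrt (\<epsilon> * w (blk j))"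
      using s[of j] L by (simp add: a_def power2_eq_square) (simp add: s_def)
    then show "(a j / s j)\<^sup>2 = 4 * \<epsilon> * w (blk j)"
      using w(1)[OF blk, of j] \<epsilon> by (simp add: power_mult_distrib)
  qed
  \<comment> \<open>The factor n undoes the averaging over workers; it is the source of the n
    squared in the variance condition.\<close>
  define c where "c i j = (if blk j = i then n * a j else 0)" for i j
  define f gf where "f i = chain_fun n d s (c i)" and "gf i = chain_grad n d s (c i)" for i
  define H where "H i x = masked n (p i) (gf i x) x" for i x
  have c_sum: "(1 / real n) * (\<Sum>i=1..n. c i j) = a j" for j
    using blk[of j] n by (simp add: c_def)
  have avg_grad: "(1 / real n) * (\<Sum>i=1..n. gf i x j) = chain_grad n d s a x j" for x j
    unfolding gf_def chain_grad_weight[of n d s "c _"] chain_grad_weight[of n d s a] sum_distrib_right[symmetric]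
    using c_sum[of j] by (metis mult.assoc)
  have avg_fun: "(1 / real n) * (\<Sum>i=1..n. f i x) = chain_fun n d s a x" for x
    unfolding f_def chain_fun_def
    by (subst sum.swap) (simp only: sum_distrib_left sum_distrib_right c_sum[symmetric] mult.assoc)
  have grad_f: "has_grad d (f i) (gf i x) x" for i x
    unfolding f_def gf_def
    by (rule has_grad_chain) (use s in \<open>auto simp: per less_imp_neq[THEN not_sym] c_def blk_def\<close>)
  have a_sum: "(\<Sum>j<d. a j) = T * (80 * \<epsilon> / L)"
  proof -
    have "(\<Sum>j<d. a j) = (\<Sum>k<T. \<Sum>i<n. a (i + k * n))"
    proof -
      have "sum a {k * n..<k * n + n} = (\<Sum>i<n. a (i + k * n))" for k
        using sum.shift_bounds_nat_ivl[of a 0 "k * n" n] by (simp add: atLeast0LessThan add.commute)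
      then show ?thesis using sum.nat_group[of a n T] by (simp add: d_def mult.commute)
    qed
    also have "\<dots> = (\<Sum>k<T. 80 * \<epsilon> / L * (\<Sum>i<n. w (Suc i)))"
      by (intro sum.cong refl) (simp add: a_eq blk_def sum_distrib_left)
    also have "(\<Sum>i<n. w (Suc i)) = (\<Sum>i=1..n. w i)"
      by (rule sum.reindex_bij_witness[of _ "\<lambda>i. i - 1" Suc]) auto
    finally show ?thesis using w(2) by simp
  qed
  have in_F: "in_F d \<Delta> L (chain_fun n d s a) (chain_grad n d s a)"
    unfolding in_F_def
  proof (intro conjI ballI)
    fix x y
    show "has_grad d (chain_fun n d s a) (chain_grad n d s a x) x"
      by (rule has_grad_chain) (use s in \<open>auto simp: per less_imp_neq[THEN not_sym]\<close>)
    show "norm_d d (vdiff (chain_grad n d s a x) (chain_grad n d s a y)) \<le> L * norm_d d (vdiff x y)"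
      using s L by (intro chain_grad_lipschitz) (auto simp: a_def)
    have "chain_fun n d s a vzero - chain_fun n d s a x \<le> 9 / 4 * (T * (80 * \<epsilon> / L))"
      using chain_fun_gap[of a n d s x] a0 a_sum by simp
    also have "\<dots> \<le> \<Delta>" using T(2) L by (simp add: field_simps)
    finally show "chain_fun n d s a vzero - chain_fun n d s a x \<le> \<Delta>" .
  qed
  have gf_other: "gf i x j = 0" if "blk j \<noteq> i" for i x j
    using that by (simp add: gf_def chain_grad_def c_def)
  interpret delayed_run n d A \<tau> p H
  proof
    show "H i x b \<in> vecs d" for i x b
      unfolding H_def gf_def by (intro masked_in_vecs chain_grad_in_vecs)
  qed (use A \<tau> p in \<open>auto intro: less_imp_le\<close>)
  have adm: "admissible_oracles n d \<sigma>2 gf (\<lambda>_. unif) G"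
    unfolding admissible_oracles_def G_def H_def
  proof (intro conjI allI ballI)
    fix i x assume i: "i \<in> {1..n}"
    show "(\<integral>\<^sup>+\<xi>. ennreal ((norm_d d (vdiff (masked n (p i) (gf i x) x (\<xi> \<le> p i)) (gf i x)))\<^sup>2) \<partial>unif) \<le> ennreal \<sigma>2"
    proof (rule masked_variance[OF p var[OF i]])
      show "(\<Sum>j\<in>{j. j < d \<and> (\<forall>m. x (j + m * n) = 0)}. (gf i x j)\<^sup>2) \<le> 4 * (real n)\<^sup>2 * \<epsilon> * w i"
        unfolding gf_def
      proof (rule chain_grad_tail_sum[where b = "i - 1"])
        show "c i j = 0" if "j mod n \<noteq> i - 1" for j using that i by (auto simp: c_def blk_def)
        show "(c i j / s j)\<^sup>2 \<le> 4 * (real n)\<^sup>2 * \<epsilon> * w i" for j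
        proof (cases "blk j = i")
          case True
          have "(c i j / s j)\<^sup>2 = (real n)\<^sup>2 * (a j / s j)\<^sup>2"
            using True by (simp add: c_def power_mult_distrib power_divide)
          then show ?thesis unfolding as(1) using True by simp
        qed (use w(1)[OF i] \<epsilon> in \<open>simp add: c_def\<close>)
      qed
    qed (use w(1)[OF i] \<epsilon> \<sigma>2 in auto)
  qed (auto simp: prob_space_unif gf_def masked_mean p intro!: masked_in_vecs chain_grad_in_vecs)
  have stuck: "run_point A \<tau> G \<omega> k (i - 1 + (T - 1) * n) = 0"
    if i: "i \<in> {1..n}" and few: "successes i t \<omega> < ennreal T" and k: "time \<omega> k \<le> t" for i \<omega> k
  proof -
    let ?N = "\<Sum>l<k. of_bool (delivers i (R \<omega> l) \<and> \<omega> (l, i) \<le> p i)"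
    \<comment> \<open>Indices beyond d are included, so the set is closed under adding n, as the
      mask condition over all m demands.\<close>
    let ?Z = "\<lambda>m. {j. blk j = i \<and> m \<le> j div n}"
    have "of_nat ?N < ennreal T" using successes_ge[OF k, of i] few by (rule le_less_trans)
    then have "ennreal (real ?N) < ennreal (real T)" unfolding ennreal_of_nat_eq_real_of_nat .
    then have "real ?N < real T" by (subst (asm) ennreal_less_iff) auto
    then have N: "?N < T" by (simp only: of_nat_less_iff)
    show ?thesis
    proof (rule progress[OF i, of ?Z])
      fix x :: vect and b m j
      assume x: "\<And>j. j \<in> ?Z m \<Longrightarrow> x j = 0" and j: "j \<in> ?Z (m + of_bool b)"
      have "j + k * n \<in> ?Z m" for k using j n by (auto simp: blk_def)
      then have tail: "x (j + k * n) = 0" for k using x by blast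
      show "H i x b j = 0"
      \<comment> \<open>A true bit still reveals only position m: at later positions the predecessor
        is in \<open>?Z m\<close>, hence 0. A false bit zeroes the masked entry.\<close>
      proof (cases b)
        case True
        then have "Suc m \<le> j div n" "blk j = i" using j by auto
        then have "n \<le> j" using n by (metis Suc_leD div_less le_0_eq not_less not_less_eq_eq zero_le)
        then have "j - n \<in> ?Z m"
          using \<open>Suc m \<le> j div n\<close> \<open>blk j = i\<close> n by (auto simp: blk_def le_mod_geq le_div_geq)
        then have "chain_pre n s x j = 0" using x \<open>n \<le> j\<close> by (auto simp: chain_pre_def)
        then show ?thesis
          using tail unfolding H_def gf_def masked_def by (subst chain_grad_at_tail) (auto simp: step_eq_0)
      qed (use tail in \<open>simp add: H_def masked_def\<close>)
    next
      show "H i' x b j = 0" if "i' \<noteq> i" "j \<in> ?Z 0" for i' x b j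
        using that gf_other by (auto simp: H_def masked_def)
      show "i - 1 + (T - 1) * n \<in> ?Z ?N" using N by (simp only: blk_at[OF i] mem_Collect_eq) linarith
    qed auto
  qed
  define E where "E i = {\<omega>. successes i t \<omega> < ennreal T}" for i
  have E: "E i \<in> sets M" for i
    unfolding E_def by (rule measurable_pred_sets) measurable
  have lower: "(\<Sum>i\<in>I. 4 * \<epsilon> * w i * indicator (E i) \<omega>) \<le> (norm_d d (chain_grad n d s a (run_point A \<tau> G \<omega> k)))\<^sup>2"
    if k: "time \<omega> k \<le> t" for \<omega> k
  proof -
    let ?g = "chain_grad n d s a (run_point A \<tau> G \<omega> k)"
    define J where "J = {i \<in> I. \<omega> \<in> E i}"
    have "\<exists>m<T. 4 * \<epsilon> * w i \<le> (?g (i - 1 + m * n))\<^sup>2" if "i \<in> J" for i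
    proof -
      have i: "i \<in> {1..n}" and few: "successes i t \<omega> < ennreal T" using that I(1) by (auto simp: J_def E_def)
      have "i - 1 < n" "T - 1 < T" using i T(1) by auto
      then obtain m where m: "m < T"
        "a (i - 1 + m * n) / s (i - 1 + m * n) \<le> \<bar>?g (i - 1 + m * n)\<bar>"
        using chain_grad_large[of s n a "i - 1" "T - 1" T "run_point A \<tau> G \<omega> k", OF s per(1) a0 _ _ stuck[OF i few k]] unfolding d_def by blast
      have "0 \<le> a (i - 1 + m * n) / s (i - 1 + m * n)" using a0 s less_imp_le by (intro divide_nonneg_nonneg) blast+
      then have "(a (i - 1 + m * n) / s (i - 1 + m * n))\<^sup>2 \<le> (?g (i - 1 + m * n))\<^sup>2"
        using m(2) by (metis power2_abs power_mono)
      moreover have "blk (i - 1 + m * n) = i" by (rule blk_at(1)[OF i])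
      ultimately show ?thesis using m(1) unfolding as(1) by auto
    qed
    then obtain m where m: "\<And>i. i \<in> J \<Longrightarrow> m i < T" "\<And>i. i \<in> J \<Longrightarrow> 4 * \<epsilon> * w i \<le> (?g (i - 1 + m i * n))\<^sup>2"
      by metis
    let ?\<kappa> = "\<lambda>i. i - 1 + m i * n"
    have J: "J \<subseteq> {1..n}" "finite J" using I(1) finite_subset[of J "{1..n}"] by (auto simp: J_def)
    \<comment> \<open>One large coordinate was picked per unfinished block. The block of a
      coordinate determines the worker, so the picks are distinct and their squares add up.\<close>
    have inj: "inj_on ?\<kappa> J"
    proof (rule inj_on_inverseI[where g = blk])
      fix i assume "i \<in> J"
      then have "i \<in> {1..n}" using J by blast
      then show "blk (?\<kappa> i) = i" by (rule blk_at(1))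
    qed
    have sub: "?\<kappa> ` J \<subseteq> {..<d}"
    proof safe
      fix i assume i: "i \<in> J"
      have "(m i + 1) * n \<le> T * n" using m(1)[OF i] by (intro mult_le_mono1) simp
      moreover have "i - 1 < n" using i J by fastforce
      ultimately show "?\<kappa> i < d" by (simp add: d_def algebra_simps)
    qed
    have "(\<Sum>i\<in>I. 4 * \<epsilon> * w i * indicator (E i) \<omega>) = (\<Sum>i\<in>J. 4 * \<epsilon> * w i)"
      unfolding J_def using finite_subset[OF I(1)]
      by (intro sum.mono_neutral_cong_right) (auto simp: indicator_def)
    also have "\<dots> \<le> (\<Sum>i\<in>J. (?g (?\<kappa> i))\<^sup>2)" by (intro sum_mono m(2))
    also have "\<dots> = (\<Sum>j\<in>?\<kappa> ` J. (?g j)\<^sup>2)" by (simp only: sum.reindex[OF inj] o_def)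
    also have "\<dots> \<le> (\<Sum>j<d. (?g j)\<^sup>2)" using sub by (intro sum_mono2) auto
    finally show ?thesis by (simp add: norm_d_power2)
  qed
  \<comment> \<open>The right side is at least 3/4 * 4 * 1/2 = 3/2 times \<open>\<epsilon>\<close>,
    which gives strictness.\<close>
  have "\<epsilon> < 3 / 4 * (\<Sum>i\<in>I. 4 * \<epsilon> * w i)"
    using I(2) \<epsilon> unfolding sum_distrib_left[symmetric] by (simp add: mult.assoc)
  then have "ennreal \<epsilon> < ennreal (3 / 4 * (\<Sum>i\<in>I. 4 * \<epsilon> * w i))"
    using \<epsilon> by (intro ennreal_lessI) auto
  also have "\<dots> \<le> (\<integral>\<^sup>+\<omega>. (INF k\<in>{k. time \<omega> k \<le> t}.
      ennreal ((norm_d d (chain_grad n d s a (run_point A \<tau> G \<omega> k)))\<^sup>2)) \<partial>M)"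
  proof (rule nn_integral_weighted_events[OF prob_space_axioms _ _ E])
    show "finite I" using I(1) finite_subset by blast
    show "0 \<le> 4 * \<epsilon> * w i" if "i \<in> I" for i using that I(1) w(1)[of i] \<epsilon> by auto
    show "3 / 4 \<le> prob (E i)" if "i \<in> I" for i
      unfolding E_def using that I(1) t T(1) by (intro prob_few_successes) auto
    show "ennreal (\<Sum>i\<in>I. 4 * \<epsilon> * w i * indicator (E i) \<omega>) \<le> (INF k\<in>{k. time \<omega> k \<le> t}.
        ennreal ((norm_d d (chain_grad n d s a (run_point A \<tau> G \<omega> k)))\<^sup>2))" for \<omega>
      by (intro INF_greatest ennreal_leI) (use lower in simp)
  qed
  finally have main: "ennreal \<epsilon> < (\<integral>\<^sup>+\<omega>. (INF k\<in>{k. time \<omega> k \<le> t}.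
      ennreal ((norm_d d (chain_grad n d s a (run_point A \<tau> G \<omega> k)))\<^sup>2)) \<partial>M)" .
  have prod: "(\<lambda>(k, i). (\<lambda>_. unif) i) = (\<lambda>_ :: nat \<times> nat. unif)" by auto
  show ?thesis
  proof (intro exI conjI)
    show "\<forall>i\<in>{1..n}. \<forall>x\<in>vecs d. has_grad d (f i) (gf i x) x" using grad_f by blast
    show "in_F d \<Delta> L (\<lambda>x. (1 / real n) * (\<Sum>i=1..n. f i x)) (\<lambda>x j. (1 / real n) * (\<Sum>i=1..n. gf i x j))"
      unfolding avg_fun avg_grad using in_F by simp
    show "admissible_oracles n d \<sigma>2 gf (\<lambda>_. unif) G" by (rule adm)
    show "(\<integral>\<^sup>+\<omega>. (INF k\<in>{k. run_time A \<tau> G \<omega> k \<le> t}.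
              ennreal ((norm_d d (\<lambda>j. (1 / real n) * (\<Sum>i=1..n. gf i (run_point A \<tau> G \<omega> k) j)))\<^sup>2))
            \<partial>(PiM (UNIV :: (nat \<times> nat) set) (\<lambda>(k, i). (\<lambda>_. unif) i))) > ennreal \<epsilon>"
      unfolding avg_grad prod using main by simp
  qed
qed

section \<open>Choice of chain length, weights and probabilities\<close>

theorem mainTheorem4:
  shows "\<exists>c c'. c > 0 \<and> c' > 0 \<and>
    (\<forall>(n::nat) (\<sigma>2::real) (\<tau>::nat \<Rightarrow> real) (L::real) (\<Delta>::real) (\<epsilon>::real) (A::nat \<Rightarrow> algo).
      n \<ge> 1 \<longrightarrow> \<sigma>2 > 0 \<longrightarrow> \<tau> 1 > 0 \<longrightarrow> (\<forall>i j. 1 \<le> i \<longrightarrow> i \<le> j \<longrightarrow> j \<le> n \<longrightarrow> \<tau> i \<le> \<tau> j) \<longrightarrow>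
      L > 0 \<longrightarrow> \<Delta> > 0 \<longrightarrow> 0 < \<epsilon> \<longrightarrow> \<epsilon> \<le> c' * L * \<Delta> \<longrightarrow>
      (\<forall>d\<ge>1. alg_ok n d (A d) \<and> zero_respecting d (A d)) \<longrightarrow>
      (\<exists>d\<ge>1. \<exists>(f::nat \<Rightarrow> vect \<Rightarrow> real) (gf::nat \<Rightarrow> vect \<Rightarrow> vect)
             (D::nat \<Rightarrow> real measure) (G::nat \<Rightarrow> vect \<Rightarrow> real \<Rightarrow> vect).
         (\<forall>i\<in>{1..n}. \<forall>x\<in>vecs d. has_grad d (f i) (gf i x) x) \<and>
         in_F d \<Delta> L (\<lambda>x. (1 / real n) * (\<Sum>i=1..n. f i x))
                     (\<lambda>x j. (1 / real n) * (\<Sum>i=1..n. gf i x j)) \<and>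
         admissible_oracles n d \<sigma>2 gf D G \<and>
         (let t = c * (\<tau> n * L * \<Delta> / \<epsilon>
                      + ((1 / real n) * (\<Sum>i=1..n. \<tau> i)) * \<sigma>2 * L * \<Delta> / (real n * \<epsilon>\<^sup>2));
              gbar = (\<lambda>x j. (1 / real n) * (\<Sum>i=1..n. gf i x j))
          in (\<integral>\<^sup>+\<omega>. (INF k\<in>{k. run_time (A d) \<tau> G \<omega> k \<le> t}.
                        ennreal ((norm_d d (gbar (run_point (A d) \<tau> G \<omega> k)))\<^sup>2))
                 \<partial>(PiM (UNIV :: (nat \<times> nat) set) (\<lambda>(k, i). D i)))
             > ennreal \<epsilon>)))"
proof (rule exI[of _ "1 / 11520"], rule exI[of _ "1 / 180"], intro conjI allI impI)
  fix n :: nat and \<sigma>2 :: real and \<tau> :: "nat \<Rightarrow> real" and L \<Delta> \<epsilon> :: real and A :: "nat \<Rightarrow> algo"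
  assume n: "n \<ge> 1" and \<sigma>2: "\<sigma>2 > 0" and \<tau>1: "\<tau> 1 > 0"
    and mono: "\<forall>i j. 1 \<le> i \<longrightarrow> i \<le> j \<longrightarrow> j \<le> n \<longrightarrow> \<tau> i \<le> \<tau> j"
    and L: "L > 0" and \<Delta>: "\<Delta> > 0" and \<epsilon>: "0 < \<epsilon>" "\<epsilon> \<le> 1 / 180 * L * \<Delta>"
    and A: "\<forall>d\<ge>1. alg_ok n d (A d) \<and> zero_respecting d (A d)"
  have \<tau>: "0 < \<tau> i" if "i \<in> {1..n}" for i
  proof -
    have "\<tau> 1 \<le> \<tau> i" using mono that by simp
    then show ?thesis using \<tau>1 by linarith
  qed
  \<comment> \<open>The longest chain that the gap \<open>\<Delta>\<close> allows. The bound 1/180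
    on \<open>\<epsilon>\<close> makes the quotient at least 1, so rounding down loses at most a
    factor 2; hence the 360 in \<open>T3\<close>.\<close>
  define T where "T = nat \<lfloor>L * \<Delta> / (180 * \<epsilon>)\<rfloor>"
  have q1: "1 \<le> L * \<Delta> / (180 * \<epsilon>)" using \<epsilon> by (simp add: field_simps)
  then have T1: "T \<ge> 1" unfolding T_def by (simp add: le_nat_iff le_floor_iff)
  have Tup: "real T \<le> L * \<Delta> / (180 * \<epsilon>)" unfolding T_def using q1 by simp
  then have T2: "180 * \<epsilon> * T \<le> L * \<Delta>" using \<epsilon> by (simp add: field_simps)
  have "L * \<Delta> / (180 * \<epsilon>) < T + 1" unfolding T_def using q1 by linarith
  then have "L * \<Delta> / (180 * \<epsilon>) < 2 * T" using T1 by linarith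
  then have T3: "L * \<Delta> / \<epsilon> \<le> 360 * T" using \<epsilon> by (simp add: field_simps)
  define d where "d = n * T"
  have d1: "d \<ge> 1" using n T1 by (simp add: d_def)
  have Ad: "alg_ok n d (A d)" "zero_respecting d (A d)" using A d1 by auto
  define S where "S = (\<Sum>i=1..n. \<tau> i)"
  have S: "S > 0" unfolding S_def using n \<tau> by (intro sum_pos) auto
  define X Y where "X = \<tau> n * L * \<Delta> / \<epsilon>" and "Y = ((1 / real n) * S) * \<sigma>2 * L * \<Delta> / (real n * \<epsilon>\<^sup>2)"
  \<comment> \<open>11520 = 2 * 4 * 4 * 360: a 2 for passing from the sum to its larger term, a 4
    from the Markov bound, a 4 from the entry size 4 \<open>\<epsilon>\<close> w inside
    \<open>p\<close>, and 360 from \<open>T3\<close>. The case of dominant Y needs all of it; the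
    other has a factor 4 to spare.\<close>
  define t where "t = 1 / 11520 * (X + Y)"
  have X0: "0 \<le> X" unfolding X_def using \<tau>[of n] n L \<Delta> \<epsilon> by simp
  have Y0: "0 \<le> Y" unfolding Y_def using S \<sigma>2 n L \<Delta> \<epsilon> by simp
  have t0: "0 \<le> t" using X0 Y0 by (simp add: t_def)
  have "\<exists>(w::nat \<Rightarrow> real) p I. (\<forall>i\<in>{1..n}. 0 < w i) \<and> (\<Sum>i=1..n. w i) = 1 \<and> (\<forall>i. 0 < p i \<and> p i \<le> 1)
    \<and> (\<forall>i\<in>{1..n}. p i = 1 \<or> 4 * (real n)\<^sup>2 * \<epsilon> * w i \<le> \<sigma>2 * p i) \<and> I \<subseteq> {1..n} \<and> 1 / 2 \<le> (\<Sum>i\<in>I. w i)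
    \<and> (\<forall>i\<in>I. p i * t \<le> \<tau> i * T / 4)"
  proof (cases "Y \<le> X")
    case True
    \<comment> \<open>The uniform half keeps every weight positive, as the scales \<open>s\<close>
      of the instance must be nonzero; the other half lets I = {n} reach weight 1/2.\<close>
    let ?w = "\<lambda>i. 1 / (2 * real n) + (if i = n then 1 / 2 else 0)"
    have "t \<le> 1 / 5760 * X" using True by (simp add: t_def)
    also have "X = \<tau> n * (L * \<Delta> / \<epsilon>)" by (simp add: X_def)
    also have "\<dots> \<le> \<tau> n * (360 * T)" using T3 \<tau>[of n] n by (intro mult_left_mono) auto
    finally have "t \<le> \<tau> n * T / 16" by (simp add: mult.commute)
    moreover have "0 \<le> \<tau> n * T" using \<tau>[of n] n by simp
    ultimately have "t \<le> \<tau> n * T / 4" by linarith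
    then show ?thesis
      using n by - (rule exI[of _ ?w], rule exI[of _ "\<lambda>_. 1"], rule exI[of _ "{n}"],
          auto simp: sum.distrib add_pos_nonneg)
  next
    case False
    let ?w = "\<lambda>i. \<tau> i / S"
    \<comment> \<open>The smallest probability that the variance budget permits, capped at 1, where
      the oracle is exact. The default 1 keeps \<open>p\<close> positive at indices that are not
      workers.\<close>
    let ?p = "\<lambda>i. if i \<in> {1..n} then min 1 (4 * (real n)\<^sup>2 * \<epsilon> * ?w i / \<sigma>2) else 1"
    have tY: "t \<le> 1 / 5760 * Y" using False by (simp add: t_def)
    have sum1: "(\<Sum>i=1..n. ?w i) = 1" using S by (simp add: sum_divide_distrib[symmetric] S_def)
    have "?p i * t \<le> \<tau> i * T / 4" if i: "i \<in> {1..n}" for i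
    proof -
      have "?p i * t \<le> (4 * (real n)\<^sup>2 * \<epsilon> * ?w i / \<sigma>2) * (1 / 5760 * Y)"
        using i tY t0 \<tau>[OF i] S \<sigma>2 \<epsilon> by (intro mult_mono) auto
      also have "\<dots> = \<tau> i / 1440 * (L * \<Delta> / \<epsilon>)"
        using n S \<sigma>2 \<epsilon> by (simp add: Y_def power2_eq_square field_simps)
      also have "\<dots> \<le> \<tau> i / 1440 * (360 * T)" using T3 \<tau>[OF i] by (intro mult_left_mono) auto
      also have "\<dots> = \<tau> i * T / 4" by simp
      finally show ?thesis .
    qed
    moreover have "?p i = 1 \<or> 4 * (real n)\<^sup>2 * \<epsilon> * ?w i \<le> \<sigma>2 * ?p i" if "i \<in> {1..n}" for i
      using that \<sigma>2 by (auto simp: min_def)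
    moreover have "0 < ?p i" "?p i \<le> 1" for i
      using \<tau>[of i] S \<epsilon> \<sigma>2 n by auto
    moreover have "0 < ?w i" if "i \<in> {1..n}" for i using \<tau>[OF that] S by simp
    ultimately show ?thesis
      using sum1 by - (rule exI[of _ ?w], rule exI[of _ ?p], rule exI[of _ "{1..n}"], simp)
  qed
  then obtain w p I where inst: "\<And>i. i \<in> {1..n} \<Longrightarrow> 0 < w i" "(\<Sum>i=1..n. w i) = 1" "\<And>i. 0 < p i" "\<And>i. p i \<le> 1"
    "\<And>i. i \<in> {1..n} \<Longrightarrow> p i = 1 \<or> 4 * (real n)\<^sup>2 * \<epsilon> * w i \<le> \<sigma>2 * p i"
    "I \<subseteq> {1..n}" "1 / 2 \<le> (\<Sum>i\<in>I. w i)" "\<And>i. i \<in> I \<Longrightarrow> p i * t \<le> \<tau> i * T / 4"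
    by metis
  note hard_instance[of n \<sigma>2 \<tau> L \<epsilon> T \<Delta> w p I t "A d", folded d_def,
      OF n \<sigma>2 \<tau> L \<epsilon>(1) T1 T2 inst(1-7) t0 inst(8) Ad]
  then show "\<exists>d\<ge>1. \<exists>(f::nat \<Rightarrow> vect \<Rightarrow> real) (gf::nat \<Rightarrow> vect \<Rightarrow> vect)
             (D::nat \<Rightarrow> real measure) (G::nat \<Rightarrow> vect \<Rightarrow> real \<Rightarrow> vect).
         (\<forall>i\<in>{1..n}. \<forall>x\<in>vecs d. has_grad d (f i) (gf i x) x) \<and>
         in_F d \<Delta> L (\<lambda>x. (1 / real n) * (\<Sum>i=1..n. f i x))
                     (\<lambda>x j. (1 / real n) * (\<Sum>i=1..n. gf i x j)) \<and>
         admissible_oracles n d \<sigma>2 gf D G \<and>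
         (let t = 1 / 11520 * (\<tau> n * L * \<Delta> / \<epsilon>
                      + ((1 / real n) * (\<Sum>i=1..n. \<tau> i)) * \<sigma>2 * L * \<Delta> / (real n * \<epsilon>\<^sup>2));
              gbar = (\<lambda>x j. (1 / real n) * (\<Sum>i=1..n. gf i x j))
          in (\<integral>\<^sup>+\<omega>. (INF k\<in>{k. run_time (A d) \<tau> G \<omega> k \<le> t}.
                        ennreal ((norm_d d (gbar (run_point (A d) \<tau> G \<omega> k)))\<^sup>2))
                 \<partial>(PiM (UNIV :: (nat \<times> nat) set) (\<lambda>(k, i). D i)))
             > ennreal \<epsilon>)"
    unfolding Let_def X_def[symmetric] S_def[symmetric] Y_def[symmetric] t_def[symmetric]
    using d1 by blast
qed simp_all

end
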